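(* Let $\Lambda$, $\gamma_i(n)$, the arrays $\mathrm B,\Theta,\mathrm E,\mathrm T$ and the generator $\mathbf R$ be as in the context. Given integers $M,N\ge1$ with $M\le\#\Lambda$, the continuous-time Markov process on $\{(\underline y,\underline n)\in\{0,1\}^\Lambda\times\mathbb Z_+^\Lambda:\ |\underline y|=M,\ |\underline n|=N\}$ with generator $\mathbf R$ is positive recurrent and reversible. Its stationary probabilities are $$\pi(\underline y,\underline n)=\frac{\mathbf 1(|\underline y|=M,\ |\underline n|=N)}{\Xi_{N,\Lambda,M}}\prod_{j\in\Lambda}[\overline\gamma_j(n_j)]^{y_j},\qquad \Xi_{N,\Lambda,M}=\sum_{\substack{\underline y\in\{0,1\}^\Lambda,\ \underline n\in\mathbb Z_+^\Lambda:\\ |\underline y|=M,\ |\underline n|=N}}\ \prod_{l\in\Lambda}[\overline\gamma_l(n_l)]^{y_l}.$$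
   Context: $\Lambda$ is a finite set of sites and $\mathbb Z_+=\{0,1,2,\dots\}$. A state is $(\underline y,\underline n)$ with $\underline y=(y_s)_{s\in\Lambda}\in\{0,1\}^\Lambda$ (configuration of sites occupied by distinguished customers) and $\underline n=(n_i)_{i\in\Lambda}\in\mathbb Z_+^\Lambda$ (numbers of tasks). $|\underline y|=\sum_sy_s$, $|\underline n|=\sum_sn_s$; write $j\in\underline y$ if $y_j=1$ and $j\notin\underline y$ if $y_j=0$. $\underline e^i$ is the unit vector at $i$, $\underline e^{i\to k}=\underline e^k-\underline e^i$, and $\mathbf 1$ is the indicator. The values $\gamma_i(n)\ge0$, $i\in\Lambda$, $n\in\mathbb Z_+$, satisfy $\gamma_i(0)=1$ and $\gamma_i(n)>0$ whenever $\gamma_i(n+1)>0$. Set $\overline\gamma_i(0)=1$, $\overline\gamma_i(n)=\prod_{0\le m<n}\gamma_i(m)$ for $n\ge1$. It is understood that $\overline\gamma_j(n_j)>0$ wherever its reciprocal appears below. The collections $\mathrm B(\underline n;\underline y)=(\beta_{kl}(n_k,n_l;\underline y))$, $\Theta(\underline n;\underline y)=(\theta_{kl}(n_k,n_l;\underline y))$, $\mathrm E(\underline n;\underline y)=(\epsilon_{ij}(n_i,n_j;\underline y))$, $\mathrm T(\underline n;\underline y)=(\tau_{jj'}(\underline n;\underline y))$ are irreducible, meaning that their off-diagonal entries are strictly positive. They satisfy: $$\beta_{kl}(n_k,n_l;\underline y)=\beta_{lk}(n_l+1,n_k-1;\underline y),\quad k\ne l,\ k,l\notin\underline y,\ n_k\ge1;$$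 $$\theta_{jk}(n_j,n_k;\underline y)=\theta_{kj}(n_k+1,n_j-1;\underline y),\quad j\in\underline y,\ k\notin\underline y,\ n_j\ge1;$$ $$\epsilon_{ij}(n_i,n_j;\underline y)\gamma_i(n_i-1)=\gamma_j(n_j)\epsilon_{ji}(n_j+1,n_i-1;\underline y),\quad i\ne j,\ i,j\in\underline y,\ n_i\ge1;$$ $$\tau_{jj'}(\underline n;\underline y)=\tau_{j'j}(\underline n;\underline y-\underline e^j+\underline e^{j'}),\quad j\in\underline y,\ j'\notin\underline y.$$ The generator $\mathbf R$ has the following off-diagonal entries (all others are zero): - $R[(\underline y,\underline n);(\underline y,\underline n+\underline e^{k\to l})]=\beta_{kl}(n_k,n_l;\underline y)\mathbf 1(n_k\ge1)$, $k\ne l$, $k,l\notin\underline y$; - $R[(\underline y,\underline n);(\underline y,\underline n+\underline e^{i\to j})]=\epsilon_{ij}(n_i,n_j;\underline y)\mathbf 1(n_i\ge1)$, $i\ne j$, $i,j\in\underline y$; - $R[(\underline y,\underline n);(\underline y,\underline n+\underline e^{i\to l})]=\theta_{il}(n_i,n_l;\underline y)\mathbf 1(n_i\ge1)$, $i\in\underline y$, $l\notin\underline y$; - $R[(\underline y,\underline n);(\underline y,\underline n+\underline e^{k\to j})]=\theta_{kj}(n_k,n_j;\underline y)\gamma_j(n_j)\mathbf 1(n_k\ge1)$, $j\in\underline y$, $k\notin\underline y$; - $R[(\underline y,\underline n);(\underline y+\underline e^{j\to j'},\underline n)]=[\overline\gamma_j(n_j)]^{-1}\tau_{jj'}(\underline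 n;\underline y)$, $j\in\underline y$, $j'\notin\underline y$. *)

theory Defs
  imports "HOL-Probability.Probability"
begin

section \<open>Continuous-time Markov processes on a finite state space\<close>

text \<open>
  A process is a family of probability measures \<open>P x\<close>, one for each initial state \<open>x\<close>,
  on a common measurable space, together with random variables \<open>X t\<close> for \<open>t \<ge> 0\<close>.
  All definitions of this section are meant for a finite set \<open>S\<close> of states.
\<close>

definition trans_prob :: "('s \<Rightarrow> 'w measure) \<Rightarrow> (real \<Rightarrow> 'w \<Rightarrow> 's) \<Rightarrow> real \<Rightarrow> 's \<Rightarrow> 's \<Rightarrow> real" where
  "trans_prob P X t x z = measure (P x) {\<omega> \<in> space (P x). X t \<omega> = z}"

text \<open>
  The conjuncts on paths, finite-dimensional distributions and derivatives are: right
  continuity for the discrete topology; the time-homogeneous Markov property (whose case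
  \<open>k = 0\<close> says that \<open>X 0 = x\<close> almost surely under \<open>P x\<close>); and \<open>R\<close> being the right derivative
  at 0 of the transition probabilities.
\<close>

definition markov_process ::
  "'s set \<Rightarrow> ('s \<Rightarrow> 's \<Rightarrow> real) \<Rightarrow> ('s \<Rightarrow> 'w measure) \<Rightarrow> (real \<Rightarrow> 'w \<Rightarrow> 's) \<Rightarrow> bool" where
  "markov_process S R P X \<longleftrightarrow>
     (\<forall>x\<in>S. prob_space (P x)) \<and>
     (\<forall>x\<in>S. \<forall>z\<in>S. sets (P x) = sets (P z)) \<and>
     (\<forall>x\<in>S. \<forall>t\<ge>0. X t \<in> measurable (P x) (count_space S)) \<and>
     (\<forall>x\<in>S. \<forall>\<omega>\<in>space (P x). \<forall>t\<ge>0. \<forall>\<^sub>F s in at_right t. X s \<omega> = X t \<omega>) \<and>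
     (\<forall>(k::nat) t z. t 0 = 0 \<and> (\<forall>i<k. t i \<le> t (Suc i)) \<and> (\<forall>i\<le>k. z i \<in> S) \<longrightarrow>
        measure (P (z 0)) {\<omega> \<in> space (P (z 0)). \<forall>i\<le>k. X (t i) \<omega> = z i} =
          (\<Prod>i<k. trans_prob P X (t (Suc i) - t i) (z i) (z (Suc i)))) \<and>
     (\<forall>x\<in>S. \<forall>z\<in>S. ((\<lambda>t. trans_prob P X t x z) has_real_derivative R x z) (at_right 0))"

definition first_jump :: "(real \<Rightarrow> 'w \<Rightarrow> 's) \<Rightarrow> 'w \<Rightarrow> ennreal" where
  "first_jump X \<omega> = (INF t\<in>{t. 0 \<le> t \<and> X t \<omega> \<noteq> X 0 \<omega>}. ennreal t)"

definition return_time :: "(real \<Rightarrow> 'w \<Rightarrow> 's) \<Rightarrow> 's \<Rightarrow> 'w \<Rightarrow> ennreal" where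
  "return_time X x \<omega> = (INF t\<in>{t. 0 \<le> t \<and> first_jump X \<omega> \<le> ennreal t \<and> X t \<omega> = x}. ennreal t)"

text \<open>
  By the usual convention an absorbing state (exit rate \<open>- R x x = 0\<close>), which has no first
  jump, counts as positive recurrent.
\<close>

definition positive_recurrent ::
  "'s set \<Rightarrow> ('s \<Rightarrow> 's \<Rightarrow> real) \<Rightarrow> ('s \<Rightarrow> 'w measure) \<Rightarrow> (real \<Rightarrow> 'w \<Rightarrow> 's) \<Rightarrow> bool" where
  "positive_recurrent S R P X \<longleftrightarrow>
     (\<forall>x\<in>S. R x x = 0 \<or> (\<integral>\<^sup>+\<omega>. return_time X x \<omega> \<partial>P x) < \<infinity>)"

text \<open>Probability of an event when the initial state has law \<open>\<nu>\<close>.\<close>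

definition prob_init :: "'s set \<Rightarrow> ('s \<Rightarrow> 'w measure) \<Rightarrow> ('s \<Rightarrow> real) \<Rightarrow> ('w \<Rightarrow> bool) \<Rightarrow> real" where
  "prob_init S P \<nu> A = (\<Sum>x\<in>S. \<nu> x * measure (P x) {\<omega> \<in> space (P x). A \<omega>})"

definition stationary_distribution ::
  "'s set \<Rightarrow> ('s \<Rightarrow> 'w measure) \<Rightarrow> (real \<Rightarrow> 'w \<Rightarrow> 's) \<Rightarrow> ('s \<Rightarrow> real) \<Rightarrow> bool" where
  "stationary_distribution S P X \<nu> \<longleftrightarrow>
     (\<forall>x\<in>S. 0 \<le> \<nu> x) \<and> (\<Sum>x\<in>S. \<nu> x) = 1 \<and>
     (\<forall>t\<ge>0. \<forall>z\<in>S. prob_init S P \<nu> (\<lambda>\<omega>. X t \<omega> = z) = \<nu> z)"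

text \<open>
  Invariance of the finite-dimensional distributions under time reversal \<open>t \<mapsto> T - t\<close>, the
  process being started from \<open>\<nu>\<close>.
\<close>

definition reversible ::
  "'s set \<Rightarrow> ('s \<Rightarrow> 'w measure) \<Rightarrow> (real \<Rightarrow> 'w \<Rightarrow> 's) \<Rightarrow> ('s \<Rightarrow> real) \<Rightarrow> bool" where
  "reversible S P X \<nu> \<longleftrightarrow>
     (\<forall>(k::nat) t z T. (\<forall>i<k. 0 \<le> t i \<and> t i \<le> T) \<longrightarrow>
        prob_init S P \<nu> (\<lambda>\<omega>. \<forall>i<k. X (t i) \<omega> = z i) =
        prob_init S P \<nu> (\<lambda>\<omega>. \<forall>i<k. X (T - t i) \<omega> = z i))"

text \<open>The generator with off-diagonal entries \<open>r\<close>; its rows sum to 0.\<close>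

definition generator :: "'s set \<Rightarrow> ('s \<Rightarrow> 's \<Rightarrow> real) \<Rightarrow> 's \<Rightarrow> 's \<Rightarrow> real" where
  "generator S r x z = (if z = x then - (\<Sum>w\<in>S - {x}. r x w) else r x z)"


section \<open>The network\<close>

text \<open>
  The sites are the elements of a finite type. A configuration in \<open>{0,1}\<^sup>\<Lambda>\<close> is
  a Boolean function \<open>y\<close>, where \<open>y j\<close> means that site \<open>j\<close> is occupied.
\<close>

type_synonym 'a config = "'a \<Rightarrow> bool"
type_synonym 'a state = "'a config \<times> ('a \<Rightarrow> nat)"

definition states :: "nat \<Rightarrow> nat \<Rightarrow> ('a::finite) state set" where
  "states M N = {(y, n). (\<Sum>s\<in>UNIV. of_bool (y s)) = M \<and> (\<Sum>s\<in>UNIV. n s) = N}"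

lemma finite_states: "finite (states M N :: ('a::finite) state set)"
proof (rule finite_subset)
  show "states M N \<subseteq> (UNIV :: 'a config set) \<times> (UNIV \<rightarrow>\<^sub>E {..N})"
    by (auto simp: states_def PiE_iff intro: member_le_sum)
  show "finite ((UNIV :: 'a config set) \<times> ((UNIV :: 'a set) \<rightarrow>\<^sub>E {..N}))"
    by (intro finite_cartesian_product finite_PiE) auto
qed

definition gamma_bar :: "('a \<Rightarrow> nat \<Rightarrow> real) \<Rightarrow> 'a \<Rightarrow> nat \<Rightarrow> real" where
  "gamma_bar \<gamma> i n = (\<Prod>m<n. \<gamma> i m)"

text \<open>\<open>n + e\<^sup>k\<^sup>\<rightarrow>\<^sup>l\<close> for \<open>k \<noteq> l\<close> and \<open>n k \<ge> 1\<close>; the subtraction truncates if \<open>n k = 0\<close>.\<close>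

definition move_task :: "'a \<Rightarrow> 'a \<Rightarrow> ('a \<Rightarrow> nat) \<Rightarrow> 'a \<Rightarrow> nat" where
  "move_task k l n = n(k := n k - 1, l := n l + 1)"

text \<open>\<open>y + e\<^sup>j\<^sup>\<rightarrow>\<^sup>j\<^sup>'\<close> for \<open>j\<close> in \<open>y\<close> and \<open>j'\<close> not in \<open>y\<close>.\<close>

definition move_customer :: "'a \<Rightarrow> 'a \<Rightarrow> 'a config \<Rightarrow> 'a config" where
  "move_customer j j' y = y(j := False, j' := True)"

text \<open>
  Each sum has at most one nonzero term, because the pair of sites can be read off from the
  source and the target of the jump; \<open>x'\<close> is reached by at most one of the five kinds of jump.
\<close>

definition jump_rate ::
  "(('a::finite) \<Rightarrow> nat \<Rightarrow> real) \<Rightarrow>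
   ('a \<Rightarrow> 'a \<Rightarrow> nat \<Rightarrow> nat \<Rightarrow> 'a config \<Rightarrow> real) \<Rightarrow>
   ('a \<Rightarrow> 'a \<Rightarrow> nat \<Rightarrow> nat \<Rightarrow> 'a config \<Rightarrow> real) \<Rightarrow>
   ('a \<Rightarrow> 'a \<Rightarrow> nat \<Rightarrow> nat \<Rightarrow> 'a config \<Rightarrow> real) \<Rightarrow>
   ('a \<Rightarrow> 'a \<Rightarrow> ('a \<Rightarrow> nat) \<Rightarrow> 'a config \<Rightarrow> real) \<Rightarrow>
   'a state \<Rightarrow> 'a state \<Rightarrow> real" where
  "jump_rate \<gamma> \<beta> \<theta> \<epsilon> \<tau> = (\<lambda>(y, n) x'.
     (\<Sum>(k, l) \<in> {(k, l). k \<noteq> l \<and> \<not> y k \<and> \<not> y l \<and> x' = (y, move_task k l n)}.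
        \<beta> k l (n k) (n l) y * of_bool (n k \<ge> 1)) +
     (\<Sum>(i, j) \<in> {(i, j). i \<noteq> j \<and> y i \<and> y j \<and> x' = (y, move_task i j n)}.
        \<epsilon> i j (n i) (n j) y * of_bool (n i \<ge> 1)) +
     (\<Sum>(i, l) \<in> {(i, l). y i \<and> \<not> y l \<and> x' = (y, move_task i l n)}.
        \<theta> i l (n i) (n l) y * of_bool (n i \<ge> 1)) +
     (\<Sum>(k, j) \<in> {(k, j). \<not> y k \<and> y j \<and> x' = (y, move_task k j n)}.
        \<theta> k j (n k) (n j) y * \<gamma> j (n j) * of_bool (n k \<ge> 1)) +
     (\<Sum>(j, j') \<in> {(j, j'). y j \<and> \<not> y j' \<and> x' = (move_customer j j' y, n)}.
        inverse (gamma_bar \<gamma> j (n j)) * \<tau> j j' n y))"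

definition weight :: "(('a::finite) \<Rightarrow> nat \<Rightarrow> real) \<Rightarrow> 'a state \<Rightarrow> real" where
  "weight \<gamma> = (\<lambda>(y, n). \<Prod>j\<in>UNIV. gamma_bar \<gamma> j (n j) ^ of_bool (y j))"

definition partition_function :: "nat \<Rightarrow> nat \<Rightarrow> (('a::finite) \<Rightarrow> nat \<Rightarrow> real) \<Rightarrow> real" where
  "partition_function M N \<gamma> = (\<Sum>x\<in>states M N. weight \<gamma> x)"

definition stat_prob :: "nat \<Rightarrow> nat \<Rightarrow> (('a::finite) \<Rightarrow> nat \<Rightarrow> real) \<Rightarrow> 'a state \<Rightarrow> real" where
  "stat_prob M N \<gamma> x = of_bool (x \<in> states M N) / partition_function M N \<gamma> * weight \<gamma> x"

end

theory Submission imports Defs begin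

text \<open>The function \<open>weight \<gamma>\<close> satisfies the detailed balance equations with the jump rates: every
  jump is paired with the reverse jump of the same kind, the \<open>\<theta>\<close>-jumps out of occupied sites with
  the \<open>\<theta>\<close>-jumps into them. The chain is irreducible, since a task can be moved
  between any two sites and a customer to any free site. What remains holds for every finite chain
  with these two properties. Detailed balance passes from the generator to the transition
  probabilities without Kolmogorov's equations, which would require two-sided derivatives.\<close>

section \<open>Finite Markov processes\<close>

text \<open>The process is given only through its finite-dimensional distributions, right-continuous
  paths and a right derivative at 0. No jump chain, holding times or strong Markov property are at
  hand, so every argument runs through probabilities of cylinder events; in particular the return
  time is bounded by sampling at equally spaced times. That the weights give the stationary
  probabilities includes uniqueness; this and finite mean return times are what irreducibility is
  for, both through a time at which all transition probabilities are positive. The product form of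
  \<open>weight\<close> mirrors the rates: a task arriving at an occupied site \<open>j\<close>
  multiplies the weight by \<open>\<gamma> j (n j)\<close>, the very factor in the rate of arrivals
  there from free sites, while between occupied sites the symmetry condition on
  \<open>\<epsilon>\<close> carries both factors. A customer moving from \<open>j\<close> to
  \<open>j'\<close> exchanges the factor of \<open>j\<close> for that of \<open>j'\<close>, which
  the reciprocals in the rates compensate.\<close>

locale finite_markov_process =
  fixes S :: "'s set" and R :: "'s \<Rightarrow> 's \<Rightarrow> real"
    and P :: "'s \<Rightarrow> 'w measure" and X :: "real \<Rightarrow> 'w \<Rightarrow> 's"
  assumes finite_S: "finite S" and process: "markov_process S R P X"
begin

abbreviation p :: "real \<Rightarrow> 's \<Rightarrow> 's \<Rightarrow> real" where
  "p \<equiv> trans_prob P X"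

section \<open>Measurability, transition matrices and the Chapman-Kolmogorov equation\<close>

lemma prob_space_P: "x \<in> S \<Longrightarrow> prob_space (P x)"
  using process by (auto simp: markov_process_def)

lemma X_measurable: "x \<in> S \<Longrightarrow> 0 \<le> t \<Longrightarrow> X t \<in> measurable (P x) (count_space S)"
  using process by (auto simp: markov_process_def)

lemma X_in: "x \<in> S \<Longrightarrow> 0 \<le> t \<Longrightarrow> \<omega> \<in> space (P x) \<Longrightarrow> X t \<omega> \<in> S"
  using measurable_space[OF X_measurable] by fastforce

lemma sets_event:
  assumes "x \<in> S" "0 \<le> t"
  shows "{\<omega> \<in> space (P x). X t \<omega> = z} \<in> sets (P x)"
proof -
  \<comment> \<open>The point \<open>z\<close> may lie outside \<open>S\<close>, where
    \<open>{z}\<close> is not a measurable set of \<open>count_space S\<close>; intersecting with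
    \<open>S\<close> covers both cases.\<close>
  have "X t -` ({z} \<inter> S) \<inter> space (P x) \<in> sets (P x)"
    by (rule measurable_sets[OF X_measurable[OF assms]]) auto
  moreover have "X t -` ({z} \<inter> S) \<inter> space (P x) = {\<omega> \<in> space (P x). X t \<omega> = z}"
    using X_in[OF assms] by auto
  ultimately show ?thesis by simp
qed

lemma sets_cylinder:
  assumes "x \<in> S" "finite I" "\<And>i. i \<in> I \<Longrightarrow> 0 \<le> t i"
  shows "{\<omega> \<in> space (P x). \<forall>i\<in>I. X (t i) \<omega> = z i} \<in> sets (P x)"
  using assms by (intro sets.sets_Collect_finite_All sets_event) auto

lemma fdd:
  fixes t :: "nat \<Rightarrow> real"
  assumes "t 0 = 0" "\<And>i. i < k \<Longrightarrow> t i \<le> t (Suc i)" "\<And>i. i \<le> k \<Longrightarrow> z i \<in> S"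
  shows "measure (P (z 0)) {\<omega> \<in> space (P (z 0)). \<forall>i\<le>k. X (t i) \<omega> = z i} =
    (\<Prod>i<k. p (t (Suc i) - t i) (z i) (z (Suc i)))"
  using process assms unfolding markov_process_def by blast

lemma p_deriv:
  "x \<in> S \<Longrightarrow> z \<in> S \<Longrightarrow> ((\<lambda>t. p t x z) has_real_derivative R x z) (at_right 0)"
  using process unfolding markov_process_def by blast

lemma p_nonneg: "0 \<le> p t x z"
  by (simp add: trans_prob_def)

lemma measure_split:
  assumes x: "x \<in> S" and t: "0 \<le> t" and E: "{\<omega> \<in> space (P x). E \<omega>} \<in> sets (P x)"
  shows "measure (P x) {\<omega> \<in> space (P x). E \<omega>} =
    (\<Sum>z\<in>S. measure (P x) {\<omega> \<in> space (P x). E \<omega> \<and> X t \<omega> = z})"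
proof -
  interpret prob_space "P x" by (rule prob_space_P[OF x])
  have sets: "{\<omega> \<in> space (P x). E \<omega> \<and> X t \<omega> = z} \<in> sets (P x)" for z
    using sets.Int[OF E sets_event[OF x t, of z]] by (simp add: Collect_conj_eq Int_ac)
  have "{\<omega> \<in> space (P x). E \<omega>} = (\<Union>z\<in>S. {\<omega> \<in> space (P x). E \<omega> \<and> X t \<omega> = z})"
    using X_in[OF x t] by auto
  also have "measure (P x) \<dots> = (\<Sum>z\<in>S. measure (P x) {\<omega> \<in> space (P x). E \<omega> \<and> X t \<omega> = z})"
    using sets finite_S by (intro finite_measure_finite_Union) (auto simp: disjoint_family_on_def)
  finally show ?thesis .
qed

lemma p_sum:
  assumes "x \<in> S" "0 \<le> t"
  shows "(\<Sum>z\<in>S. p t x z) = 1"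
  using measure_split[OF assms, of "\<lambda>_. True"] prob_space.prob_space[OF prob_space_P[OF assms(1)]]
  by (simp add: trans_prob_def)

lemma p_0_same: "x \<in> S \<Longrightarrow> p 0 x x = 1"
  using fdd[of "\<lambda>_. 0" 0 "\<lambda>_. x"] by (simp add: trans_prob_def)

text \<open>The diagonal entry 1 already exhausts the row sum, so the other entries, being
  nonnegative, vanish.\<close>

lemma p_0:
  assumes "x \<in> S" "z \<in> S"
  shows "p 0 x z = of_bool (x = z)"
proof (cases "x = z")
  case False
  have "(\<Sum>z\<in>S. p 0 x z) = p 0 x x + (\<Sum>z\<in>S - {x}. p 0 x z)"
    using assms finite_S by (simp add: sum.remove)
  then have "(\<Sum>z\<in>S - {x}. p 0 x z) = 0"
    using p_sum[of x 0] p_0_same assms by simp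
  then show ?thesis
    using False assms finite_S by (simp add: sum_nonneg_eq_0_iff p_nonneg)
qed (use p_0_same assms in auto)

text \<open>The process starts in \<open>x\<close> only almost surely, so other values of \<open>z 0\<close> have to be excluded.\<close>

lemma measure_start:
  assumes "x \<in> S" "z \<noteq> x" "E \<subseteq> {\<omega> \<in> space (P x). X 0 \<omega> = z}"
  shows "measure (P x) E = 0"
proof -
  interpret prob_space "P x" by (rule prob_space_P[OF assms(1)])
  have "measure (P x) {\<omega> \<in> space (P x). X 0 \<omega> = z} = 0"
  proof (cases "z \<in> S")
    case True
    then show ?thesis using p_0[of x z] assms by (simp add: trans_prob_def)
  next
    case False
    then have "{\<omega> \<in> space (P x). X 0 \<omega> = z} = {}" using X_in[OF assms(1)] by auto
    then show ?thesis by (metis measure_empty)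
  qed
  then show ?thesis
    using finite_measure_mono[OF assms(3)] sets_event[OF assms(1)]
    by (metis measure_le_0_iff order.refl)
qed

text \<open>The Markov property in \<open>fdd\<close> speaks only of times starting at 0 and of the
  measure \<open>P (z 0)\<close>. Prepending time 0 and the state \<open>x\<close> to the sequences
  reduces the general case to it; splitting over the value of \<open>X 0\<close> costs nothing, as
  all values except \<open>x\<close> have probability 0.\<close>

lemma fdd_from:
  fixes t :: "nat \<Rightarrow> real"
  assumes x: "x \<in> S" and t0: "0 \<le> t 0" and t: "\<And>i. i < k \<Longrightarrow> t i \<le> t (Suc i)"
    and z: "\<And>i. i \<le> k \<Longrightarrow> z i \<in> S"
  shows "measure (P x) {\<omega> \<in> space (P x). \<forall>i\<le>k. X (t i) \<omega> = z i} =
    p (t 0) x (z 0) * (\<Prod>i<k. p (t (Suc i) - t i) (z i) (z (Suc i)))"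
proof -
  interpret prob_space "P x" by (rule prob_space_P[OF x])
  define t' where "t' = case_nat 0 t"
  define z' where "z' = case_nat x z"
  have tnn: "0 \<le> t i" if "i \<le> k" for i
    using that
  proof (induction i)
    case (Suc i)
    then show ?case using t[of i] by simp
  qed (use t0 in simp)
  let ?A = "\<lambda>a. {\<omega> \<in> space (P x). (\<forall>i\<le>k. X (t i) \<omega> = z i) \<and> X 0 \<omega> = a}"
  have A: "{\<omega> \<in> space (P x). \<forall>i\<le>k. X (t i) \<omega> = z i} \<in> sets (P x)"
    unfolding atMost_iff[symmetric] Ball_def[symmetric] by (rule sets_cylinder[OF x]) (use tnn in auto)
  have "measure (P x) {\<omega> \<in> space (P x). \<forall>i\<le>k. X (t i) \<omega> = z i} = (\<Sum>a\<in>S. measure (P x) (?A a))"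
    by (rule measure_split[OF x _ A]) simp
  also have "\<dots> = (\<Sum>a\<in>S. if a = x then measure (P x) (?A x) else 0)"
    by (intro sum.cong) (auto intro!: measure_start[OF x])
  also have "\<dots> = measure (P x) (?A x)"
    using x finite_S by simp
  also have "?A x = {\<omega> \<in> space (P x). \<forall>i\<le>Suc k. X (t' i) \<omega> = z' i}"
    by (simp only: atMost_iff[symmetric] atMost_Suc_eq_insert_0 t'_def z'_def) auto
  also have "measure (P x) \<dots> = (\<Prod>i<Suc k. p (t' (Suc i) - t' i) (z' i) (z' (Suc i)))"
    using fdd[of t' "Suc k" z'] t t0 z x
    by (auto simp: t'_def z'_def split: nat.splits)
  also have "\<dots> = p (t 0) x (z 0) * (\<Prod>i<k. p (t (Suc i) - t i) (z i) (z (Suc i)))"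
    by (subst prod.lessThan_Suc_shift) (simp add: t'_def z'_def)
  finally show ?thesis .
qed

lemma chapman_kolmogorov:
  assumes "x \<in> S" "z \<in> S" "0 \<le> s" "0 \<le> t"
  shows "p (s + t) x z = (\<Sum>w\<in>S. p s x w * p t w z)"
proof -
  have "p (s + t) x z =
      (\<Sum>w\<in>S. measure (P x) {\<omega> \<in> space (P x). X (s + t) \<omega> = z \<and> X s \<omega> = w})"
    unfolding trans_prob_def using assms by (intro measure_split sets_event) auto
  also have "\<dots> = (\<Sum>w\<in>S. p s x w * p t w z)"
  proof (rule sum.cong[OF refl])
    fix w assume w: "w \<in> S"
    have "{\<omega> \<in> space (P x). X (s + t) \<omega> = z \<and> X s \<omega> = w} =
      {\<omega> \<in> space (P x). \<forall>i\<le>1. X ([s, s + t] ! i) \<omega> = [w, z] ! i}"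
      by (auto simp: le_Suc_eq)
    moreover have "[w, z] ! i \<in> S" if "i \<le> 1" for i
      using that assms w by (auto simp: le_Suc_eq)
    ultimately show "measure (P x) {\<omega> \<in> space (P x). X (s + t) \<omega> = z \<and> X s \<omega> = w} = p s x w * p t w z"
      using fdd_from[of x "\<lambda>i. [s, s + t] ! i" 1 "\<lambda>i. [w, z] ! i"] assms by simp
  qed
  finally show ?thesis .
qed

section \<open>Small times: right continuity and positivity\<close>

lemma p_tendsto:
  assumes "x \<in> S" "z \<in> S"
  shows "((\<lambda>h. (p h x z - p 0 x z) / h) \<longlongrightarrow> R x z) (at_right 0)"
  using p_deriv[OF assms] by (simp add: has_field_derivative_iff)

text \<open>The right derivative at 0 yields right continuity there, and
  \<open>p 0 x x = 1\<close>.\<close>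

lemma p_pos_same:
  assumes "x \<in> S"
  shows "\<forall>\<^sub>F h in at_right 0. 0 < p h x x"
proof -
  have "continuous (at_right 0) (\<lambda>t. p t x x)"
    using p_deriv[OF assms assms] by (rule has_field_derivative_imp_has_derivative[THEN has_derivative_continuous])
  then have "((\<lambda>t. p t x x) \<longlongrightarrow> 1) (at_right 0)"
    using p_0_same[OF assms] by (simp add: continuous_within)
  then show ?thesis by (rule order_tendstoD) simp
qed

text \<open>For distinct states \<open>p 0 x z = 0\<close>, so the difference quotient is
  \<open>p h x z / h\<close>, and its limit is the positive rate.\<close>

lemma p_pos_edge:
  assumes "x \<in> S" "z \<in> S" "0 < R x z"
  shows "\<forall>\<^sub>F h in at_right 0. 0 < p h x z"
proof (cases "x = z")
  case False
  have "\<forall>\<^sub>F h in at_right 0. 0 < (p h x z - p 0 x z) / h"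
    using p_tendsto[OF assms(1,2)] assms(3) by (rule order_tendstoD)
  then show ?thesis
    using eventually_at_right_less[of 0]
    by eventually_elim (use False p_0[OF assms(1,2)] in \<open>simp add: zero_less_divide_iff\<close>)
qed (use p_pos_same assms in auto)

definition edges :: "('s \<times> 's) set" where
  "edges = {(x, z). x \<in> S \<and> z \<in> S \<and> 0 < R x z}"

text \<open>Positive probability of staying put makes the positive entries of the powers of \<open>p h\<close>
  accumulate, so a single power has all entries positive.\<close>

lemma all_p_pos:
  assumes irr: "\<And>x z. x \<in> S \<Longrightarrow> z \<in> S \<Longrightarrow> (x, z) \<in> edges\<^sup>*"
  obtains t where "0 < t" "\<And>x z. x \<in> S \<Longrightarrow> z \<in> S \<Longrightarrow> 0 < p t x z"
proof -
  have "\<forall>\<^sub>F h in at_right 0. (\<forall>x\<in>S. 0 < p h x x) \<and> (\<forall>e\<in>edges. 0 < p h (fst e) (snd e))"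
  proof (intro eventually_conj eventually_ball_finite finite_S ballI p_pos_same)
    show "finite edges"
      by (rule finite_subset[of _ "S \<times> S"]) (auto simp: edges_def finite_S)
  qed (auto simp: edges_def intro: p_pos_edge)
  then have "\<forall>\<^sub>F h in at_right 0. 0 < h \<and> (\<forall>x\<in>S. 0 < p h x x) \<and> (\<forall>e\<in>edges. 0 < p h (fst e) (snd e))"
    using eventually_at_right_less[of "0::real"] by (auto elim: eventually_elim2)
  then have "\<exists>h. 0 < h \<and> (\<forall>x\<in>S. 0 < p h x x) \<and> (\<forall>e\<in>edges. 0 < p h (fst e) (snd e))"
    by (rule eventually_happens'[rotated]) simp
  then obtain h where h: "0 < h" and stay: "\<And>x. x \<in> S \<Longrightarrow> 0 < p h x x"
    and edge: "\<And>x z. (x, z) \<in> edges \<Longrightarrow> 0 < p h x z"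
    by (metis fst_conv snd_conv)
  have prod_pos: "0 < p (s + u) x z"
    if "0 < p s x w" "0 < p u w z" "x \<in> S" "w \<in> S" "z \<in> S" "0 \<le> s" "0 \<le> u" for s u x w z
    using that finite_S
    by (auto simp: chapman_kolmogorov p_nonneg intro!: sum_pos2[of _ w])
  have mono: "0 < p (real (n + m) * h) x z" if "0 < p (real n * h) x z" "x \<in> S" "z \<in> S" for n m x z
  proof (induction m)
    case (Suc m)
    then show ?case
      using prod_pos[OF Suc stay[of z]] that h by (simp add: algebra_simps)
  qed (use that in simp)
  have ex: "\<exists>n. 0 < p (real n * h) x z" if "(x, z) \<in> edges\<^sup>*" "x \<in> S" for x z
    using that
  proof (induction rule: rtrancl_induct)
    case base
    then show ?case by (intro exI[of _ 0]) (simp add: p_0_same)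
  next
    case (step v z)
    then obtain n where n: "0 < p (real n * h) x v" by auto
    have "0 < p (real n * h + h) x z"
      using prod_pos[OF n edge[OF step(2)]] step h by (auto simp: edges_def)
    then show ?case by (intro exI[of _ "Suc n"]) (simp add: algebra_simps)
  qed
  have "\<exists>N. \<forall>e\<in>S\<times>S. 0 < p (real (N e) * h) (fst e) (snd e)"
    using ex irr by (intro bchoice) auto
  then obtain N where N: "\<And>x z. x \<in> S \<Longrightarrow> z \<in> S \<Longrightarrow> 0 < p (real (N (x, z)) * h) x z"
    by auto
  \<comment> \<open>The sum bounds every \<open>N e\<close>; \<open>Suc\<close> keeps the time
    positive even if all \<open>N e\<close> are 0.\<close>
  define K where "K = Suc (\<Sum>e\<in>S\<times>S. N e)"
  show ?thesis
  proof
    show "0 < real K * h" using h by (simp add: K_def del: of_nat_Suc)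
    fix x z assume xz: "x \<in> S" "z \<in> S"
    then have "N (x, z) \<le> (\<Sum>e\<in>S\<times>S. N e)"
      using finite_S by (intro member_le_sum) auto
    then show "0 < p (real K * h) x z"
      using mono[OF N[OF xz] xz, of "K - N (x, z)"] by (simp add: K_def)
  qed
qed

text \<open>The total violation of detailed balance at time \<open>t\<close> is subadditive in \<open>t\<close> and, by detailed
  balance of the generator, \<open>o(t)\<close> at 0; hence it vanishes identically.\<close>

lemma detailed_balance:
  assumes db: "\<And>x z. x \<in> S \<Longrightarrow> z \<in> S \<Longrightarrow> \<pi> x * R x z = \<pi> z * R z x"
    and xz: "x \<in> S" "z \<in> S" and t: "0 \<le> t"
  shows "\<pi> x * p t x z = \<pi> z * p t z x"
proof -
  define D where "D t x z = \<pi> x * p t x z - \<pi> z * p t z x" for t x z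
  define A where "A t = (\<Sum>x\<in>S. \<Sum>z\<in>S. \<bar>D t x z\<bar>)" for t
  have D_add: "D (s + t) x z = (\<Sum>w\<in>S. D s x w * p t w z + p s w x * D t w z)"
    if "x \<in> S" "z \<in> S" "0 \<le> s" "0 \<le> t" for s t x z
  proof -
    \<comment> \<open>The second term is expanded in the order \<open>t + s\<close>, so that in both
      products the step of length \<open>s\<close> joins \<open>x\<close> and \<open>w\<close> and
      the step of length \<open>t\<close> joins \<open>w\<close> and \<open>z\<close>. Then
      \<open>\<pi> w * p s w x * p t w z\<close> is added and subtracted.\<close>
    have "D (s + t) x z = \<pi> x * p (s + t) x z - \<pi> z * p (t + s) z x"
      by (simp add: D_def add.commute)
    also have "\<dots> = (\<Sum>w\<in>S. \<pi> x * (p s x w * p t w z) - \<pi> z * (p t z w * p s w x))"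
      using that by (simp add: chapman_kolmogorov sum_distrib_left sum_subtractf)
    also have "\<dots> = (\<Sum>w\<in>S. D s x w * p t w z + p s w x * D t w z)"
      by (intro sum.cong) (auto simp: D_def algebra_simps)
    finally show ?thesis .
  qed
  have A_add: "A (s + t) \<le> A s + A t" if st: "0 \<le> s" "0 \<le> t" for s t
  proof -
    have "A (s + t) \<le> (\<Sum>x\<in>S. \<Sum>z\<in>S. \<Sum>w\<in>S. \<bar>D s x w\<bar> * p t w z + p s w x * \<bar>D t w z\<bar>)"
      unfolding A_def
    proof (intro sum_mono)
      fix x z assume "x \<in> S" "z \<in> S"
      then have "\<bar>D (s + t) x z\<bar> \<le> (\<Sum>w\<in>S. \<bar>D s x w * p t w z + p s w x * D t w z\<bar>)"
        by (simp add: D_add st)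
      also have "\<dots> \<le> (\<Sum>w\<in>S. \<bar>D s x w\<bar> * p t w z + p s w x * \<bar>D t w z\<bar>)"
        by (intro sum_mono order.trans[OF abs_triangle_ineq]) (simp add: abs_mult p_nonneg)
      finally show "\<bar>D (s + t) x z\<bar> \<le> \<dots>" .
    qed
    \<comment> \<open>Each half contains one transition probability with a free target,
      \<open>z\<close> in the first and \<open>x\<close> in the second; summing over it gives
      1.\<close>
    also have "\<dots> = (\<Sum>x\<in>S. \<Sum>z\<in>S. \<Sum>w\<in>S. \<bar>D s x w\<bar> * p t w z) +
        (\<Sum>x\<in>S. \<Sum>z\<in>S. \<Sum>w\<in>S. p s w x * \<bar>D t w z\<bar>)"
      by (simp add: sum.distrib)
    also have "(\<Sum>x\<in>S. \<Sum>z\<in>S. \<Sum>w\<in>S. \<bar>D s x w\<bar> * p t w z) =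
        (\<Sum>x\<in>S. \<Sum>w\<in>S. \<bar>D s x w\<bar> * (\<Sum>z\<in>S. p t w z))"
      by (rule sum.cong[OF refl], subst sum.swap) (simp add: sum_distrib_left)
    also have "\<dots> = A s"
      by (simp add: A_def p_sum st)
    also have "(\<Sum>x\<in>S. \<Sum>z\<in>S. \<Sum>w\<in>S. p s w x * \<bar>D t w z\<bar>) =
        (\<Sum>z\<in>S. \<Sum>x\<in>S. \<Sum>w\<in>S. p s w x * \<bar>D t w z\<bar>)"
      by (rule sum.swap)
    also have "\<dots> = (\<Sum>z\<in>S. \<Sum>w\<in>S. (\<Sum>x\<in>S. p s w x) * \<bar>D t w z\<bar>)"
      by (rule sum.cong[OF refl], subst sum.swap) (simp add: sum_distrib_right)
    also have "\<dots> = (\<Sum>z\<in>S. \<Sum>w\<in>S. \<bar>D t w z\<bar>)"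
      by (simp add: p_sum st)
    also have "\<dots> = A t"
      unfolding A_def by (rule sum.swap)
    finally show ?thesis .
  qed
  have A_0: "A 0 = 0"
    unfolding A_def by (intro sum.neutral ballI) (auto simp: D_def p_0)
  have A_mult: "A (real n * h) \<le> real n * A h" if h: "0 \<le> h" for n h
  proof (induction n)
    case (Suc n)
    then show ?case
      using A_add[of "real n * h" h] h by (simp add: algebra_simps)
  qed (simp add: A_0)
  have "((\<lambda>h. \<Sum>x\<in>S. \<Sum>z\<in>S. \<bar>\<pi> x * ((p h x z - p 0 x z) / h) - \<pi> z * ((p h z x - p 0 z x) / h)\<bar>)
      \<longlongrightarrow> (\<Sum>x\<in>S. \<Sum>z\<in>S. \<bar>\<pi> x * R x z - \<pi> z * R z x\<bar>)) (at_right 0)"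
    by (intro tendsto_sum tendsto_rabs tendsto_diff tendsto_mult tendsto_const p_tendsto)
  then have "((\<lambda>h. \<Sum>x\<in>S. \<Sum>z\<in>S. \<bar>\<pi> x * ((p h x z - p 0 x z) / h) - \<pi> z * ((p h z x - p 0 z x) / h)\<bar>)
      \<longlongrightarrow> 0) (at_right 0)"
    by (simp add: db)
  moreover have "\<forall>\<^sub>F h in at_right 0.
      (\<Sum>x\<in>S. \<Sum>z\<in>S. \<bar>\<pi> x * ((p h x z - p 0 x z) / h) - \<pi> z * ((p h z x - p 0 z x) / h)\<bar>) = A h / h"
    using eventually_at_right_less[of 0]
  proof eventually_elim
    case (elim h)
    have "\<bar>\<pi> x * ((p h x z - p 0 x z) / h) - \<pi> z * ((p h z x - p 0 z x) / h)\<bar> = \<bar>D h x z\<bar> / h"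
      if "x \<in> S" "z \<in> S" for x z
    proof -
      have "\<pi> x * p 0 x z = \<pi> z * p 0 z x" using that by (auto simp: p_0)
      then have "\<pi> x * ((p h x z - p 0 x z) / h) - \<pi> z * ((p h z x - p 0 z x) / h) = D h x z / h"
        by (simp add: D_def field_simps diff_divide_distrib)
      then show ?thesis using elim by simp
    qed
    then show ?case
      by (simp add: A_def sum_divide_distrib)
  qed
  ultimately have lim: "((\<lambda>h. A h / h) \<longlongrightarrow> 0) (at_right 0)"
    by (rule Lim_transform_eventually)
  have "A t \<le> 0"
  proof (cases "t = 0")
    case False
    then have t: "0 < t" using t by simp
    \<comment> \<open>With \<open>u = t / (n + 1)\<close>, subadditivity gives
      \<open>A t \<le> (n + 1) * A u = t * (A u / u)\<close>, and the right-hand side tends to 0 by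
      \<open>lim\<close>.\<close>
    have "(\<lambda>n. t * inverse (real (Suc n))) \<longlonglongrightarrow> t * 0"
      by (intro tendsto_mult tendsto_const LIMSEQ_inverse_real_of_nat)
    then have "filterlim (\<lambda>n. t * inverse (real (Suc n))) (at_right 0) sequentially"
      using t by (simp add: filterlim_at del: of_nat_Suc)
    then have "(\<lambda>n. A (t * inverse (real (Suc n))) / (t * inverse (real (Suc n)))) \<longlonglongrightarrow> 0"
      by (rule filterlim_compose[OF lim])
    then have "(\<lambda>n. t * (A (t * inverse (real (Suc n))) / (t * inverse (real (Suc n))))) \<longlonglongrightarrow> t * 0"
      by (intro tendsto_mult tendsto_const)
    moreover have "A t \<le> t * (A (t * inverse (real (Suc n))) / (t * inverse (real (Suc n))))" for n
    proof -
      have "A t = A (real (Suc n) * (t * inverse (real (Suc n))))"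
        by (simp add: field_simps del: of_nat_Suc)
      also have "\<dots> \<le> real (Suc n) * A (t * inverse (real (Suc n)))"
        using t by (intro A_mult) simp
      also have "\<dots> = t * (A (t * inverse (real (Suc n))) / (t * inverse (real (Suc n))))"
        using t by (simp add: field_simps del: of_nat_Suc)
      finally show ?thesis .
    qed
    ultimately show ?thesis
      by (intro LIMSEQ_le_const[where X = "\<lambda>n. t * (A (t * inverse (real (Suc n))) / (t * inverse (real (Suc n))))"])
        auto
  qed (simp add: A_0)
  moreover have "\<bar>D t x z\<bar> \<le> (\<Sum>z\<in>S. \<bar>D t x z\<bar>)"
    using xz finite_S by (intro member_le_sum) auto
  moreover have "(\<Sum>z\<in>S. \<bar>D t x z\<bar>) \<le> A t"
    unfolding A_def using xz finite_S by (intro member_le_sum[where f = "\<lambda>x. \<Sum>z\<in>S. \<bar>D t x z\<bar>"]) (auto intro: sum_nonneg)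
  ultimately show ?thesis
    by (simp add: D_def)
qed

section \<open>Stationarity, time reversal and uniqueness\<close>

lemma prob_init_p: "prob_init S P \<nu> (\<lambda>\<omega>. X t \<omega> = z) = (\<Sum>x\<in>S. \<nu> x * p t x z)"
  by (simp add: prob_init_def trans_prob_def)

lemma stationary:
  assumes db: "\<And>x z. x \<in> S \<Longrightarrow> z \<in> S \<Longrightarrow> \<pi> x * R x z = \<pi> z * R z x"
    and "z \<in> S" "0 \<le> t"
  shows "(\<Sum>x\<in>S. \<pi> x * p t x z) = \<pi> z"
proof -
  have "(\<Sum>x\<in>S. \<pi> x * p t x z) = (\<Sum>x\<in>S. \<pi> z * p t z x)"
    using assms by (intro sum.cong refl detailed_balance[OF db]) auto
  then show ?thesis
    using assms by (simp add: sum_distrib_left[symmetric] p_sum)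
qed

text \<open>Stationarity absorbs the initial stretch up to \<open>t 0\<close>, so only the
  increments of the times remain.\<close>

lemma prob_init_fdd:
  fixes t :: "nat \<Rightarrow> real"
  assumes db: "\<And>x z. x \<in> S \<Longrightarrow> z \<in> S \<Longrightarrow> \<pi> x * R x z = \<pi> z * R z x"
    and t: "0 \<le> t 0" "\<And>i. i < k \<Longrightarrow> t i \<le> t (Suc i)" and z: "\<And>i. i \<le> k \<Longrightarrow> z i \<in> S"
  shows "prob_init S P \<pi> (\<lambda>\<omega>. \<forall>i\<le>k. X (t i) \<omega> = z i) =
    \<pi> (z 0) * (\<Prod>i<k. p (t (Suc i) - t i) (z i) (z (Suc i)))"
proof -
  have "prob_init S P \<pi> (\<lambda>\<omega>. \<forall>i\<le>k. X (t i) \<omega> = z i) =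
      (\<Sum>x\<in>S. \<pi> x * p (t 0) x (z 0) * (\<Prod>i<k. p (t (Suc i) - t i) (z i) (z (Suc i))))"
    unfolding prob_init_def using t z by (intro sum.cong refl) (simp add: fdd_from)
  also have "\<dots> = \<pi> (z 0) * (\<Prod>i<k. p (t (Suc i) - t i) (z i) (z (Suc i)))"
    using t z by (simp add: sum_distrib_right[symmetric] stationary[OF db])
  finally show ?thesis .
qed

text \<open>Detailed balance turns the factors round one at a time, carrying \<open>\<pi>\<close>
  from \<open>z 0\<close> along to \<open>z k\<close>. The result is the path probability for the
  reversed times, once these are enumerated backwards and hence in increasing order.\<close>

lemma prob_init_reverse:
  fixes t :: "nat \<Rightarrow> real"
  assumes db: "\<And>x z. x \<in> S \<Longrightarrow> z \<in> S \<Longrightarrow> \<pi> x * R x z = \<pi> z * R z x"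
    and t: "0 \<le> t 0" "\<And>i. i < k \<Longrightarrow> t i \<le> t (Suc i)" "t k \<le> T"
    and z: "\<And>i. i \<le> k \<Longrightarrow> z i \<in> S"
  shows "prob_init S P \<pi> (\<lambda>\<omega>. \<forall>i\<le>k. X (t i) \<omega> = z i) =
    prob_init S P \<pi> (\<lambda>\<omega>. \<forall>i\<le>k. X (T - t i) \<omega> = z i)"
proof -
  have swap: "\<pi> (z 0) * (\<Prod>i<j. p (t (Suc i) - t i) (z i) (z (Suc i))) =
      \<pi> (z j) * (\<Prod>i<j. p (t (Suc i) - t i) (z (Suc i)) (z i))" if "j \<le> k" for j
    using that
  proof (induction j)
    case (Suc j)
    have "\<pi> (z j) * p (t (Suc j) - t j) (z j) (z (Suc j)) =
        \<pi> (z (Suc j)) * p (t (Suc j) - t j) (z (Suc j)) (z j)"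
      using Suc.prems t z by (intro detailed_balance[OF db]) auto
    then show ?case
      using Suc by (simp add: mult.assoc[symmetric])
  qed simp
  have "prob_init S P \<pi> (\<lambda>\<omega>. \<forall>i\<le>k. X (T - t i) \<omega> = z i) =
      prob_init S P \<pi> (\<lambda>\<omega>. \<forall>i\<le>k. X (T - t (k - i)) \<omega> = z (k - i))"
    by (rule arg_cong[where f = "prob_init S P \<pi>"]) (metis diff_diff_cancel diff_le_self)
  also have "\<dots> = \<pi> (z (k - 0)) * (\<Prod>i<k. p ((T - t (k - Suc i)) - (T - t (k - i))) (z (k - i)) (z (k - Suc i)))"
  proof (rule prob_init_fdd[OF db])
    fix i assume "i < k"
    then show "T - t (k - i) \<le> T - t (k - Suc i)"
      using t(2)[of "k - Suc i"] by (simp add: Suc_diff_Suc)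
  qed (use t z in auto)
  also have "\<dots> = \<pi> (z k) * (\<Prod>i<k. p (t (Suc (k - Suc i)) - t (k - Suc i)) (z (Suc (k - Suc i))) (z (k - Suc i)))"
    by (simp add: Suc_diff_Suc)
  also have "\<dots> = \<pi> (z k) * (\<Prod>i<k. p (t (Suc i) - t i) (z (Suc i)) (z i))"
    by (subst prod.nat_diff_reindex) simp
  also have "\<dots> = prob_init S P \<pi> (\<lambda>\<omega>. \<forall>i\<le>k. X (t i) \<omega> = z i)"
    using t z by (subst prob_init_fdd[OF db]) (auto simp: swap)
  finally show ?thesis ..
qed

text \<open>The definition admits times in any order and with repetitions, no times at all, and
  states outside \<open>S\<close>. In the last case both events are empty; otherwise sorting reduces
  the claim to monotone times.\<close>

lemma reversibleI:
  assumes db: "\<And>x z. x \<in> S \<Longrightarrow> z \<in> S \<Longrightarrow> \<pi> x * R x z = \<pi> z * R z x"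
  shows "reversible S P X \<pi>"
  unfolding reversible_def
proof (intro allI impI)
  fix k :: nat and t :: "nat \<Rightarrow> real" and z T
  assume t: "\<forall>i<k. 0 \<le> t i \<and> t i \<le> T"
  show "prob_init S P \<pi> (\<lambda>\<omega>. \<forall>i<k. X (t i) \<omega> = z i) =
        prob_init S P \<pi> (\<lambda>\<omega>. \<forall>i<k. X (T - t i) \<omega> = z i)"
  proof (cases "k = 0 \<or> (\<exists>i<k. z i \<notin> S)")
    case True
    then consider "k = 0" | i where "i < k" "z i \<notin> S" by auto
    then show ?thesis
    proof cases
      case 2
      have "{\<omega> \<in> space (P x). \<forall>i<k. X (t i) \<omega> = z i} = {}"
        "{\<omega> \<in> space (P x). \<forall>i<k. X (T - t i) \<omega> = z i} = {}" if "x \<in> S" for x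
        using 2 t X_in[OF that, of "t i"] X_in[OF that, of "T - t i"] by fastforce+
      then show ?thesis by (simp only: prob_init_def cong: sum.cong)
    qed simp
  next
    case False
    define m where "m = k - 1"
    \<comment> \<open>The indices are sorted by their times, rather than the times themselves, so
      that each state stays attached to its time.\<close>
    define L where "L = sort_key t [0..<k]"
    have L: "length L = Suc m" "set L = {..<k}" "sorted (map t L)"
      using False by (auto simp: L_def m_def)
    have L_less: "L ! i < k" if "i \<le> m" for i
      using nth_mem[of i L] that L by auto
    have all_L: "(\<forall>i<k. Q i) \<longleftrightarrow> (\<forall>i\<le>m. Q (L ! i))" for Q
      using all_set_conv_all_nth[of L Q] L by (auto simp: less_Suc_eq_le)
    show ?thesis
      unfolding all_L
    proof (rule prob_init_reverse[OF db])
      show "t (L ! i) \<le> t (L ! Suc i)" if "i < m" for i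
        using that L sorted_nth_mono[OF L(3), of i "Suc i"] by simp
    qed (use t False L_less in auto)
  qed
qed

lemma stationary_distributionI:
  assumes db: "\<And>x z. x \<in> S \<Longrightarrow> z \<in> S \<Longrightarrow> \<pi> x * R x z = \<pi> z * R z x"
    and "\<And>x. x \<in> S \<Longrightarrow> 0 \<le> \<pi> x" "sum \<pi> S = 1"
  shows "stationary_distribution S P X \<pi>"
  using assms stationary[OF db] by (simp add: stationary_distribution_def prob_init_p)

text \<open>By detailed balance, \<open>\<nu> / \<pi>\<close> is harmonic for \<open>p t\<close>; the maximum principle makes it constant.\<close>

lemma stationary_distribution_unique:
  assumes db: "\<And>x z. x \<in> S \<Longrightarrow> z \<in> S \<Longrightarrow> \<pi> x * R x z = \<pi> z * R z x"
    and pos: "\<And>x. x \<in> S \<Longrightarrow> 0 < \<pi> x" and sum: "sum \<pi> S = 1"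
    and irr: "\<And>x z. x \<in> S \<Longrightarrow> z \<in> S \<Longrightarrow> (x, z) \<in> edges\<^sup>*"
    and \<nu>: "stationary_distribution S P X \<nu>" and x: "x \<in> S"
  shows "\<nu> x = \<pi> x"
proof -
  \<comment> \<open>At such a time one step of the maximum principle suffices, since every state
    enters the mean with positive weight.\<close>
  obtain t where t: "0 < t" and p_pos: "\<And>x z. x \<in> S \<Longrightarrow> z \<in> S \<Longrightarrow> 0 < p t x z"
    using all_p_pos irr by metis
  define f where "f x = \<nu> x / \<pi> x" for x
  have \<nu>_eq: "\<nu> x = f x * \<pi> x" if "x \<in> S" for x
    using pos[OF that] by (simp add: f_def)
  have "Max (f ` S) \<in> f ` S"
    using x finite_S by (intro Max_in) auto
  then obtain z where z: "z \<in> S" "f z = Max (f ` S)" by auto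
  have le: "f x \<le> f z" if "x \<in> S" for x
    using that z finite_S by simp
  have "\<pi> z * f z = \<nu> z"
    using z by (simp add: \<nu>_eq)
  also have "\<dots> = (\<Sum>x\<in>S. \<nu> x * p t x z)"
    using \<nu> t z by (simp add: stationary_distribution_def prob_init_p)
  also have "\<dots> = (\<Sum>x\<in>S. f x * (\<pi> x * p t x z))"
    by (intro sum.cong) (auto simp: \<nu>_eq)
  also have "\<dots> = (\<Sum>x\<in>S. f x * (\<pi> z * p t z x))"
    using t z by (intro sum.cong refl arg_cong2[where f = "(*)"] detailed_balance[OF db]) auto
  also have "\<dots> = \<pi> z * (\<Sum>x\<in>S. p t z x * f x)"
    by (simp add: sum_distrib_left mult_ac)
  finally have "f z = (\<Sum>x\<in>S. p t z x * f x)"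
    using pos[OF z(1)] by simp
  moreover have "f z = (\<Sum>x\<in>S. p t z x * f z)"
    using p_sum[of z t] z t by (simp add: sum_distrib_right[symmetric])
  ultimately have "(\<Sum>x\<in>S. p t z x * (f z - f x)) = 0"
    by (simp add: right_diff_distrib sum_subtractf)
  then have "\<forall>x\<in>S. p t z x * (f z - f x) = 0"
    using le by (subst (asm) sum_nonneg_eq_0_iff) (auto simp: finite_S p_nonneg)
  then have const: "f x = f z" if "x \<in> S" for x
    using p_pos[OF z(1) that] that by auto
  have "1 = (\<Sum>x\<in>S. \<nu> x)"
    using \<nu> by (simp add: stationary_distribution_def)
  also have "\<dots> = (\<Sum>x\<in>S. f z * \<pi> x)"
    using \<nu>_eq const by (intro sum.cong) auto
  also have "\<dots> = f z"
    by (simp add: sum_distrib_left[symmetric] sum)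
  finally show ?thesis
    using \<nu>_eq[OF x] const[OF x] by simp
qed

section \<open>Return times through the skeleton at multiples of \<open>h\<close>\<close>

text \<open>A simple Markov property for events of the sampled past: the hypothesis on
  \<open>Q\<close> says that it looks only at the samples 0 to \<open>n\<close>. Such an event is a
  finite disjoint union of path cylinders, and extending a cylinder with last state
  \<open>z n\<close> by \<open>v\<close> multiplies its probability by \<open>p h (z n) v\<close>,
  which is at least \<open>c\<close>. With \<open>c = 0\<close> the lemma also serves for
  measurability alone.\<close>

lemma skeleton_step:
  fixes h c :: real and n :: nat
  assumes x: "x \<in> S" and v: "v \<in> S" and h: "0 \<le> h"
    and c: "\<And>w. w \<in> S \<Longrightarrow> c \<le> p h w v"
    and Q: "\<And>z z'. (\<And>i. i \<le> n \<Longrightarrow> z i = z' i) \<Longrightarrow> Q z = Q z'"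
  shows "{\<omega> \<in> space (P x). Q (\<lambda>i. X (real i * h) \<omega>)} \<in> sets (P x)" (is "?E \<in> _")
    and "{\<omega> \<in> space (P x). Q (\<lambda>i. X (real i * h) \<omega>) \<and> X (real (Suc n) * h) \<omega> = v} \<in> sets (P x)"
      (is "?F \<in> _")
    and "c * measure (P x) {\<omega> \<in> space (P x). Q (\<lambda>i. X (real i * h) \<omega>)} \<le>
      measure (P x) {\<omega> \<in> space (P x). Q (\<lambda>i. X (real i * h) \<omega>) \<and> X (real (Suc n) * h) \<omega> = v}"
proof -
  interpret prob_space "P x" by (rule prob_space_P[OF x])
  \<comment> \<open>Extensional functions make the index set finite and force distinct indices to
    differ at some sample, so that their cylinders are disjoint.\<close>
  define I where "I = {z \<in> {..n} \<rightarrow>\<^sub>E S. Q z}"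
  define C where "C z = {\<omega> \<in> space (P x). \<forall>i\<le>n. X (real i * h) \<omega> = z i}" for z
  define D where "D z = {\<omega> \<in> space (P x). \<forall>i\<le>Suc n. X (real i * h) \<omega> = (z(Suc n := v)) i}" for z
  have I: "finite I"
    unfolding I_def using finite_S by (intro finite_subset[OF _ finite_PiE[of "{..n}" "\<lambda>_. S"]]) auto
  have C: "C z \<in> sets (P x)" for z
    unfolding C_def atMost_iff[symmetric] Ball_def[symmetric]
    by (rule sets_cylinder[OF x]) (use h in auto)
  have D: "D z \<in> sets (P x)" for z
    unfolding D_def atMost_iff[symmetric] Ball_def[symmetric]
    by (rule sets_cylinder[OF x]) (use h in auto)
  have D_alt: "D z = {\<omega> \<in> C z. X (real (Suc n) * h) \<omega> = v}" for z
    unfolding C_def D_def by (auto simp: le_Suc_eq)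
  have path: "\<exists>z\<in>I. \<omega> \<in> C z" if "\<omega> \<in> ?E" for \<omega>
    using that X_in[OF x] h Q[of "restrict (\<lambda>i. X (real i * h) \<omega>) {..n}" "\<lambda>i. X (real i * h) \<omega>"]
    by (intro bexI[of _ "restrict (\<lambda>i. X (real i * h) \<omega>) {..n}"]) (auto simp: I_def C_def)
  have C_Q: "Q (\<lambda>i. X (real i * h) \<omega>)" if "\<omega> \<in> C z" "z \<in> I" for \<omega> z
    using that Q[of "\<lambda>i. X (real i * h) \<omega>" z] by (auto simp: I_def C_def)
  have E_eq: "?E = (\<Union>z\<in>I. C z)"
    using path C_Q by (auto simp: C_def)
  have F_eq: "?F = (\<Union>z\<in>I. D z)"
    unfolding D_alt using path C_Q by (auto simp: C_def)
  show "?E \<in> sets (P x)" "?F \<in> sets (P x)"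
    unfolding E_eq F_eq using I C D by auto
  have disj: "disjoint_family_on C I"
  proof (unfold disjoint_family_on_def, intro ballI impI)
    fix z z' assume z: "z \<in> I" "z' \<in> I" "z \<noteq> z'"
    then have "\<exists>i\<in>{..n}. z i \<noteq> z' i"
      using PiE_ext[of z "{..n}" "\<lambda>_. S" z'] by (auto simp: I_def)
    then show "C z \<inter> C z' = {}" by (auto simp: C_def)
  qed
  then have disj': "disjoint_family_on D I"
    unfolding disjoint_family_on_def D_alt by blast
  have "c * measure (P x) (C z) \<le> measure (P x) (D z)" if "z \<in> I" for z
  proof -
    have z: "z i \<in> S" if "i \<le> n" for i using that \<open>z \<in> I\<close> by (auto simp: I_def)
    have "measure (P x) (C z) = p 0 x (z 0) * (\<Prod>i<n. p (real (Suc i) * h - real i * h) (z i) (z (Suc i)))"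
      unfolding C_def using fdd_from[OF x, of "\<lambda>i. real i * h" n z] h z by (simp add: mult_right_mono)
    moreover have "measure (P x) (D z) = p 0 x (z 0) *
        (\<Prod>i<Suc n. p (real (Suc i) * h - real i * h) ((z(Suc n := v)) i) ((z(Suc n := v)) (Suc i)))"
      unfolding D_def using fdd_from[OF x, of "\<lambda>i. real i * h" "Suc n" "z(Suc n := v)"] h z v
      by (simp add: mult_right_mono)
    moreover have "\<dots> = p 0 x (z 0) * (\<Prod>i<n. p (real (Suc i) * h - real i * h) (z i) (z (Suc i))) * p h (z n) v"
      by (simp add: algebra_simps)
    ultimately have "measure (P x) (D z) = measure (P x) (C z) * p h (z n) v"
      by simp
    then show ?thesis
      using c[OF z[of n]] by (simp add: mult.commute[of c] mult_left_mono)
  qed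
  then have "(\<Sum>z\<in>I. c * measure (P x) (C z)) \<le> (\<Sum>z\<in>I. measure (P x) (D z))"
    by (rule sum_mono)
  moreover have "measure (P x) ?E = (\<Sum>z\<in>I. measure (P x) (C z))"
    unfolding E_eq using I C disj by (intro finite_measure_finite_Union) auto
  moreover have "measure (P x) ?F = (\<Sum>z\<in>I. measure (P x) (D z))"
    unfolding F_eq using I D disj' by (intro finite_measure_finite_Union) auto
  ultimately show "c * measure (P x) ?E \<le> measure (P x) ?F"
    by (simp add: sum_distrib_left)
qed

text \<open>A detour through \<open>w\<close> certifies that a jump has happened, whatever
  \<open>X 0\<close> is: if \<open>X 0\<close> is \<open>w\<close>, the state at \<open>t\<close>
  differs from it, and otherwise the state at \<open>s\<close> does. This is a pointwise bound,
  although the start in \<open>x\<close> is only almost sure.\<close>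

lemma return_time_le:
  assumes "0 \<le> s" "s \<le> t" "X s \<omega> = w" "X t \<omega> = x" "w \<noteq> x"
  shows "return_time X x \<omega> \<le> ennreal t"
proof -
  have "first_jump X \<omega> \<le> ennreal t"
  proof (cases "X 0 \<omega> = w")
    case True
    then show ?thesis
      unfolding first_jump_def using assms by (intro INF_lower) auto
  next
    case False
    then have "first_jump X \<omega> \<le> ennreal s"
      unfolding first_jump_def using assms by (intro INF_lower) auto
    then show ?thesis
      using assms by (meson ennreal_leI order_trans)
  qed
  then show ?thesis
    unfolding return_time_def using assms by (intro INF_lower) auto
qed

text \<open>Sample the process at the multiples of a time \<open>h\<close> with all \<open>p h\<close> at least \<open>c > 0\<close>. In each
  block of two steps it visits \<open>w\<close> and then \<open>x\<close> with probability at least \<open>c\<^sup>2\<close>, whatever the past,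
  so the number of blocks until return is dominated by a geometric variable.\<close>

lemma nn_integral_return_time:
  assumes irr: "\<And>x z. x \<in> S \<Longrightarrow> z \<in> S \<Longrightarrow> (x, z) \<in> edges\<^sup>*"
    and x: "x \<in> S" and w: "w \<in> S" "w \<noteq> x"
  shows "(\<integral>\<^sup>+\<omega>. return_time X x \<omega> \<partial>P x) < \<infinity>"
proof -
  interpret prob_space "P x" by (rule prob_space_P[OF x])
  obtain h where h: "0 < h" and p_pos: "\<And>x z. x \<in> S \<Longrightarrow> z \<in> S \<Longrightarrow> 0 < p h x z"
    using all_p_pos irr by metis
  define c where "c = Min ((\<lambda>(x, z). p h x z) ` (S \<times> S))"
  have "c \<in> (\<lambda>(x, z). p h x z) ` (S \<times> S)"
    unfolding c_def using x finite_S by (intro Min_in) auto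
  then have c_pos: "0 < c" using p_pos by auto
  have c_le: "c \<le> p h x z" if "x \<in> S" "z \<in> S" for x z
    unfolding c_def using finite_S that by (intro Min_le) (auto intro!: image_eqI[of _ _ "(x, z)"])
  have "p h x x \<le> 1"
    unfolding trans_prob_def by (rule prob_le_1)
  then have "c \<le> 1"
    using c_le[OF x x] by simp
  define q where "q = 1 - c\<^sup>2"
  have q: "0 \<le> q" "q < 1"
    using c_pos \<open>c \<le> 1\<close> by (auto simp: q_def power_le_one)
  \<comment> \<open>Block \<open>i\<close> consists of the samples \<open>2 * i + 1\<close> and
    \<open>2 * i + 2\<close>, so \<open>Q k\<close>, failure of the first \<open>k\<close> blocks,
    depends on the samples up to \<open>2 * k\<close>.\<close>
  define Q where "Q k z \<longleftrightarrow> (\<forall>i<k. \<not> (z (2 * i + 1) = w \<and> z (2 * i + 2) = x))" for k and z :: "nat \<Rightarrow> 's"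
  have Q_cong: "Q k z = Q k z'" if eq: "\<And>i. i \<le> 2 * k \<Longrightarrow> z i = z' i" for k z z'
  proof -
    have "z (2 * i + 1) = z' (2 * i + 1)" "z (2 * i + 2) = z' (2 * i + 2)" if "i < k" for i
      by (rule eq, use that in simp)+
    then show ?thesis by (simp add: Q_def)
  qed
  define E where "E k = {\<omega> \<in> space (P x). Q k (\<lambda>i. X (real i * h) \<omega>)}" for k
  have E_sets: "E k \<in> sets (P x)" for k
    unfolding E_def
    by (rule skeleton_step(1)[where c = 0, OF x x _ p_nonneg Q_cong]) (use h in auto)
  have E_le: "measure (P x) (E k) \<le> q ^ k" for k
  proof (induction k)
    case 0
    then show ?case by simp
  next
    case (Suc k)
    let ?Q' = "\<lambda>z. Q k z \<and> z (Suc (2 * k)) = w"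
    let ?F = "{\<omega> \<in> space (P x). ?Q' (\<lambda>i. X (real i * h) \<omega>)}"
    let ?G = "{\<omega> \<in> space (P x). ?Q' (\<lambda>i. X (real i * h) \<omega>) \<and> X (real (Suc (Suc (2 * k))) * h) \<omega> = x}"
    have Q'_cong: "?Q' z = ?Q' z'" if "\<And>i. i \<le> Suc (2 * k) \<Longrightarrow> z i = z' i" for z z'
      using that Q_cong[of k z z'] by auto
    \<comment> \<open>The block is entered in two steps, first to \<open>w\<close> and then to
      \<open>x\<close>, each costing a factor \<open>c\<close>.\<close>
    have "c * measure (P x) (E k) \<le> measure (P x) ?F"
      unfolding E_def
      by (rule order.trans[OF skeleton_step(3)[OF x w(1) _ c_le[OF _ w(1)] Q_cong]])
        (use h in auto)
    then have "c * (c * measure (P x) (E k)) \<le> c * measure (P x) ?F"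
      using c_pos by (intro mult_left_mono) auto
    also have "\<dots> \<le> measure (P x) ?G"
      by (rule skeleton_step(3)[OF x x _ c_le[OF _ x] Q'_cong]) (use h in auto)
    finally have G: "c\<^sup>2 * measure (P x) (E k) \<le> measure (P x) ?G"
      by (simp add: power2_eq_square)
    have G_sets: "?G \<in> sets (P x)"
      by (rule skeleton_step(2)[where c = 0, OF x x _ p_nonneg Q'_cong]) (use h in auto)
    have "E (Suc k) = E k - ?G"
      by (auto simp: E_def Q_def less_Suc_eq)
    also have "measure (P x) \<dots> = measure (P x) (E k) - measure (P x) ?G"
      by (rule finite_measure_Diff[OF E_sets G_sets]) (auto simp: E_def)
    also have "\<dots> \<le> q * measure (P x) (E k)"
      using G by (simp add: q_def algebra_simps)
    also have "\<dots> \<le> q * q ^ k"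
      using Suc q by (intro mult_left_mono) auto
    finally show ?case by simp
  qed
  \<comment> \<open>If block \<open>K\<close> is the first success, \<open>\<omega>\<close> lies in
    \<open>E 0\<close> to \<open>E K\<close> and the return occurs by time
    \<open>(2 * K + 2) * h\<close>, which is \<open>2 * h\<close> for each of these events. Without
    any success the series is infinite.\<close>
  have "return_time X x \<omega> \<le> (\<Sum>k. ennreal (2 * h) * indicator (E k) \<omega>)" if \<omega>: "\<omega> \<in> space (P x)" for \<omega>
  proof (cases "\<exists>i. X (real (2 * i + 1) * h) \<omega> = w \<and> X (real (2 * i + 2) * h) \<omega> = x")
    case True
    define K where "K = (LEAST i. X (real (2 * i + 1) * h) \<omega> = w \<and> X (real (2 * i + 2) * h) \<omega> = x)"
    have K: "X (real (2 * K + 1) * h) \<omega> = w" "X (real (2 * K + 2) * h) \<omega> = x"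
      using LeastI_ex[OF True] by (auto simp: K_def)
    have E_mem: "\<omega> \<in> E k" if "k < Suc K" for k
    proof -
      have "\<not> (X (real (2 * i + 1) * h) \<omega> = w \<and> X (real (2 * i + 2) * h) \<omega> = x)" if "i < K" for i
        using that unfolding K_def by (rule not_less_Least)
      then show ?thesis
        using that \<omega> unfolding E_def Q_def by simp
    qed
    have "real (2 * K + 2) * h = (\<Sum>k<Suc K. 2 * h)"
      by (simp add: algebra_simps)
    then have "ennreal (real (2 * K + 2) * h) = ennreal (\<Sum>k<Suc K. 2 * h)"
      by (rule arg_cong)
    also have "\<dots> = (\<Sum>k<Suc K. ennreal (2 * h))"
      using h by (intro sum_ennreal[symmetric]) auto
    also have "\<dots> = (\<Sum>k<Suc K. ennreal (2 * h) * indicator (E k) \<omega>)"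
      by (intro sum.cong refl) (auto simp: E_mem indicator_def)
    also have "\<dots> \<le> (\<Sum>k. ennreal (2 * h) * indicator (E k) \<omega>)"
      by (rule sum_le_suminf) auto
    finally have "ennreal (real (2 * K + 2) * h) \<le> (\<Sum>k. ennreal (2 * h) * indicator (E k) \<omega>)" .
    moreover have "return_time X x \<omega> \<le> ennreal (real (2 * K + 2) * h)"
      by (rule return_time_le[OF _ _ K w(2)]) (use h in auto)
    ultimately show ?thesis by (rule order.trans[rotated])
  next
    case False
    then have "(\<Sum>k. ennreal (2 * h) * indicator (E k) \<omega>) = (\<Sum>k::nat. ennreal (2 * h))"
      using \<omega> by (intro suminf_cong) (auto simp: E_def Q_def)
    also have "\<dots> = top"
    proof (rule ccontr)
      assume "(\<Sum>k::nat. ennreal (2 * h)) \<noteq> top"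
      then have "summable (\<lambda>k::nat. 2 * h)"
        using h by (intro summable_suminf_not_top) auto
      then show False
        using h by (simp add: summable_const_iff)
    qed
    finally show ?thesis by simp
  qed
  then have "(\<integral>\<^sup>+\<omega>. return_time X x \<omega> \<partial>P x) \<le> (\<integral>\<^sup>+\<omega>. (\<Sum>k. ennreal (2 * h) * indicator (E k) \<omega>) \<partial>P x)"
    by (rule nn_integral_mono)
  also have "\<dots> = (\<Sum>k. ennreal (2 * h) * emeasure (P x) (E k))"
    using E_sets by (simp add: nn_integral_suminf nn_integral_cmult)
  also have "\<dots> \<le> (\<Sum>k. ennreal (2 * h * q ^ k))"
    using E_le h q
    by (intro suminf_le) (auto simp: emeasure_eq_measure ennreal_mult[symmetric] intro!: ennreal_leI)
  also have "\<dots> = ennreal (\<Sum>k. 2 * h * q ^ k)"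
    using h q by (intro suminf_ennreal2 summable_mult summable_geometric) auto
  also have "\<dots> < \<infinity>" by simp
  finally show ?thesis .
qed

lemma positive_recurrentI:
  assumes irr: "\<And>x z. x \<in> S \<Longrightarrow> z \<in> S \<Longrightarrow> (x, z) \<in> edges\<^sup>*"
  shows "positive_recurrent S R P X"
  unfolding positive_recurrent_def
proof
  fix x assume x: "x \<in> S"
  show "R x x = 0 \<or> (\<integral>\<^sup>+\<omega>. return_time X x \<omega> \<partial>P x) < \<infinity>"
  \<comment> \<open>A detour needs a second state; a single state is absorbing, because its
    transition probability is constantly 1.\<close>
  proof (cases "S = {x}")
    case True
    have "((\<lambda>h. (p h x x - p 0 x x) / h) \<longlongrightarrow> 0) (at_right 0)"
    proof (rule Lim_transform_eventually[OF tendsto_const])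
      show "\<forall>\<^sub>F h in at_right 0. 0 = (p h x x - p 0 x x) / h"
        using eventually_at_right_less[of 0]
        by eventually_elim (use p_sum[OF x] True in simp)
    qed
    then have "R x x = 0"
      using tendsto_unique[OF trivial_limit_at_right_real p_tendsto[OF x x]] by simp
    then show ?thesis by simp
  next
    case False
    then obtain w where "w \<in> S" "w \<noteq> x" using x by auto
    then show ?thesis using nn_integral_return_time[OF irr x] by simp
  qed
qed

end

section \<open>The network\<close>

text \<open>Summing over pairs rather than over target states, the detailed balance equations need no
  discussion of which pair of sites a jump comes from.\<close>

lemma sum_pairs_swap:
  fixes f g :: "'a::finite \<Rightarrow> 'a \<Rightarrow> real"
  assumes "\<And>k l. A k l \<Longrightarrow> f k l \<noteq> 0 \<Longrightarrow> B l k \<and> g l k = f k l"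
    and "\<And>k l. B l k \<Longrightarrow> g l k \<noteq> 0 \<Longrightarrow> A k l \<and> f k l = g l k"
  shows "(\<Sum>(k, l)\<in>{(k, l). A k l}. f k l) = (\<Sum>(l, k)\<in>{(l, k). B l k}. g l k)"
proof -
  \<comment> \<open>Vanishing terms are dropped before the index sets are matched: a move out of an
    empty site, where subtraction truncates, is not undone by the reverse move.\<close>
  have "(\<Sum>(k, l)\<in>{(k, l). A k l}. f k l) = (\<Sum>(k, l)\<in>{(k, l). A k l \<and> f k l \<noteq> 0}. f k l)"
    by (rule sum.mono_neutral_right) auto
  also have "\<dots> = (\<Sum>(l, k)\<in>{(l, k). B l k \<and> g l k \<noteq> 0}. g l k)"
  proof (rule sum.reindex_bij_witness[of _ "\<lambda>(l, k). (k, l)" "\<lambda>(k, l). (l, k)"])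
    show "(case a of (k, l) \<Rightarrow> (l, k)) \<in> {(l, k). B l k \<and> g l k \<noteq> 0}"
      "(case case a of (k, l) \<Rightarrow> (l, k) of (l, k) \<Rightarrow> g l k) = (case a of (k, l) \<Rightarrow> f k l)"
      if "a \<in> {(k, l). A k l \<and> f k l \<noteq> 0}" for a
      using that assms(1)[of "fst a" "snd a"] by (cases a; simp)+
    show "(case b of (l, k) \<Rightarrow> (k, l)) \<in> {(k, l). A k l \<and> f k l \<noteq> 0}"
      if "b \<in> {(l, k). B l k \<and> g l k \<noteq> 0}" for b
      using that assms(2)[of "fst b" "snd b"] by (cases b; simp)
  qed auto
  also have "\<dots> = (\<Sum>(l, k)\<in>{(l, k). B l k}. g l k)"
    by (rule sum.mono_neutral_left) auto
  finally show ?thesis .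
qed

section \<open>The product weight under single moves\<close>

lemma gamma_bar_Suc: "gamma_bar \<gamma> i (Suc n) = gamma_bar \<gamma> i n * \<gamma> i n"
  by (simp add: gamma_bar_def)

lemma weight_split:
  fixes k l :: "'a::finite"
  assumes "k \<noteq> l"
  shows "weight \<gamma> (y, n) = gamma_bar \<gamma> k (n k) ^ of_bool (y k) * gamma_bar \<gamma> l (n l) ^ of_bool (y l) *
    (\<Prod>j\<in>UNIV - {k, l}. gamma_bar \<gamma> j (n j) ^ of_bool (y j))"
proof -
  have "prod g UNIV = g k * g l * prod g (UNIV - {k, l})" for g :: "'a \<Rightarrow> real"
  proof -
    have "prod g UNIV = g k * (g l * prod g (UNIV - {k} - {l}))"
      using assms prod.remove[of UNIV k g] prod.remove[of "UNIV - {k}" l g] by simp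
    moreover have "UNIV - {k} - {l} = UNIV - {k, l}" by auto
    ultimately show ?thesis by (simp only: mult.assoc)
  qed
  from this[of "\<lambda>j. gamma_bar \<gamma> j (n j) ^ of_bool (y j)"] show ?thesis
    by (simp only: weight_def prod.case)
qed

lemma weight_move_task:
  assumes "k \<noteq> l"
  shows "weight \<gamma> (y, move_task k l n) =
    gamma_bar \<gamma> k (n k - 1) ^ of_bool (y k) * gamma_bar \<gamma> l (n l + 1) ^ of_bool (y l) *
    (\<Prod>j\<in>UNIV - {k, l}. gamma_bar \<gamma> j (n j) ^ of_bool (y j))"
proof -
  have rest: "(\<Prod>j\<in>UNIV - {k, l}. gamma_bar \<gamma> j (move_task k l n j) ^ of_bool (y j)) =
      (\<Prod>j\<in>UNIV - {k, l}. gamma_bar \<gamma> j (n j) ^ of_bool (y j))"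
    by (intro prod.cong) (auto simp: move_task_def)
  have at: "move_task k l n k = n k - 1" "move_task k l n l = n l + 1"
    using assms by (auto simp: move_task_def)
  show ?thesis
    by (simp only: weight_split[OF assms] rest at)
qed

lemma weight_move_customer:
  assumes "y j" "\<not> y j'"
  shows "weight \<gamma> (move_customer j j' y, n) * gamma_bar \<gamma> j (n j) = weight \<gamma> (y, n) * gamma_bar \<gamma> j' (n j')"
proof -
  have neq: "j \<noteq> j'" using assms by auto
  have rest: "(\<Prod>i\<in>UNIV - {j, j'}. gamma_bar \<gamma> i (n i) ^ of_bool (move_customer j j' y i)) =
      (\<Prod>i\<in>UNIV - {j, j'}. gamma_bar \<gamma> i (n i) ^ of_bool (y i))"
    by (intro prod.cong) (auto simp: move_customer_def)
  have at: "move_customer j j' y j = False" "move_customer j j' y j' = True"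
    using neq by (auto simp: move_customer_def)
  show ?thesis
    by (simp only: weight_split[OF neq] rest at assms of_bool_eq power_one_right power_0 mult_1_left mult_1_right mult_ac)
qed

section \<open>Reversing moves, conservation of totals and connectedness by moves\<close>

lemma move_task_target: "move_task k l n l = n l + 1"
  by (simp add: move_task_def)

lemma move_customer_target: "move_customer j j' y j'"
  by (simp add: move_customer_def)

lemma move_customer_source: "j \<noteq> j' \<Longrightarrow> \<not> move_customer j j' y j"
  by (simp add: move_customer_def)

lemma move_task_back: "k \<noteq> l \<Longrightarrow> 1 \<le> n k \<Longrightarrow> move_task l k (move_task k l n) = n"
  by (auto simp: move_task_def)

lemma move_customer_back: "y j \<Longrightarrow> \<not> y j' \<Longrightarrow> move_customer j' j (move_customer j j' y) = y"
  by (auto simp: move_customer_def fun_eq_iff)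

lemma sum_move_task:
  fixes n :: "'a::finite \<Rightarrow> nat"
  assumes "k \<noteq> l" "1 \<le> n k"
  shows "(\<Sum>s\<in>UNIV. move_task k l n s) = (\<Sum>s\<in>UNIV. n s)"
proof -
  have split: "(\<Sum>s\<in>UNIV. f s) = f k + f l + (\<Sum>s\<in>UNIV - {k, l}. f s)" for f :: "'a \<Rightarrow> nat"
  proof -
    have "sum f UNIV = f k + (f l + sum f (UNIV - {k} - {l}))"
      using assms sum.remove[of UNIV k f] sum.remove[of "UNIV - {k}" l f] by simp
    moreover have "UNIV - {k} - {l} = UNIV - {k, l}" by auto
    ultimately show ?thesis by (simp only: add.assoc)
  qed
  have "(\<Sum>s\<in>UNIV - {k, l}. move_task k l n s) = (\<Sum>s\<in>UNIV - {k, l}. n s)"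
    by (intro sum.cong) (auto simp: move_task_def)
  moreover have "move_task k l n k + move_task k l n l = n k + n l"
    using assms by (simp add: move_task_def)
  ultimately show ?thesis
    by (simp only: split[of n] split[of "move_task k l n"])
qed

text \<open>Read as 0-1 vectors, configurations change by task moves, so conservation of the number
  of customers follows from that of tasks.\<close>

lemma of_bool_move_customer:
  "y j \<Longrightarrow> \<not> y j' \<Longrightarrow> (\<lambda>s. of_bool (move_customer j j' y s)) = move_task j j' (\<lambda>s. of_bool (y s))"
  by (auto simp: move_customer_def move_task_def)

lemma move_task_in_states:
  "(y, n) \<in> states M N \<Longrightarrow> k \<noteq> l \<Longrightarrow> 1 \<le> n k \<Longrightarrow> (y, move_task k l n) \<in> states M N"
  by (auto simp: states_def sum_move_task)

lemma move_customer_in_states: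
  "(y, n) \<in> states M N \<Longrightarrow> y j \<Longrightarrow> \<not> y j' \<Longrightarrow> (move_customer j j' y, n) \<in> states M N"
proof -
  assume "(y, n) \<in> states M N" and y: "y j" "\<not> y j'"
  moreover have "(\<Sum>s\<in>UNIV. of_bool (move_customer j j' y s)) = (\<Sum>s\<in>UNIV. of_bool (y s) :: nat)"
    unfolding of_bool_move_customer[of y, OF y] by (rule sum_move_task) (use y in auto)
  ultimately show ?thesis
    by (simp only: states_def mem_Collect_eq prod.case)
qed

lemma exists_surplus_deficit:
  fixes n n' :: "'a::finite \<Rightarrow> nat"
  assumes "(\<Sum>s\<in>UNIV. n s) = (\<Sum>s\<in>UNIV. n' s)" "n \<noteq> n'"
  obtains k l where "n' k < n k" "n l < n' l"
proof -
  have *: "\<exists>k. b k < a k" if "sum a UNIV = sum b UNIV" "a \<noteq> b" for a b :: "'a \<Rightarrow> nat"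
  proof (rule ccontr)
    assume "\<nexists>k. b k < a k"
    then have "a k \<le> b k" for k by (simp add: not_less)
    then have "a = b"
      using sum_mono_inv[OF that(1)] by auto
    with that show False by simp
  qed
  show ?thesis
    using *[OF assms] *[OF assms(1)[symmetric] assms(2)[symmetric]] that by blast
qed

text \<open>Subtraction on \<open>nat\<close> truncates, so the sum is the total surplus over
  \<open>n'\<close>. The move lowers the term of \<open>k\<close>, while that of \<open>l\<close>
  stays 0 because of the deficit there.\<close>

lemma move_task_closer:
  fixes n n' :: "'a::finite \<Rightarrow> nat"
  assumes "n' k < n k" "n l < n' l"
  shows "(\<Sum>s\<in>UNIV. move_task k l n s - n' s) < (\<Sum>s\<in>UNIV. n s - n' s)"
proof (rule sum_strict_mono_ex1)
  show "\<forall>s\<in>UNIV. move_task k l n s - n' s \<le> n s - n' s"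
    using assms by (auto simp: move_task_def)
  show "\<exists>s\<in>UNIV. move_task k l n s - n' s < n s - n' s"
    using assms by (intro bexI[of _ k]) (auto simp: move_task_def)
qed simp

text \<open>Move single units from a surplus site to a deficit site. The invariant \<open>Q\<close> is needed because
  only states with the right numbers of tasks and customers are of interest, and \<open>f\<close> allows the same
  argument for configurations, read as 0-1 vectors.\<close>

lemma move_task_connected:
  fixes n n' :: "'a::finite \<Rightarrow> nat"
  assumes "(\<Sum>s\<in>UNIV. n s) = (\<Sum>s\<in>UNIV. n' s)"
    and "\<And>n k l. Q n \<Longrightarrow> n' k < n k \<Longrightarrow> n l < n' l \<Longrightarrow> Q (move_task k l n) \<and> (f n, f (move_task k l n)) \<in> r"
    and "Q n"
  shows "(f n, f n') \<in> r\<^sup>*"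
  using assms(1,3)
proof (induction "\<Sum>s\<in>UNIV. n s - n' s" arbitrary: n rule: less_induct)
  case less
  show ?case
  proof (cases "n = n'")
    case False
    then obtain k l where kl: "n' k < n k" "n l < n' l"
      using exists_surplus_deficit less.prems(1) by metis
    then have "k \<noteq> l" "1 \<le> n k" by auto
    then have "(f (move_task k l n), f n') \<in> r\<^sup>*"
      using less kl assms(2) by (intro less.hyps move_task_closer) (auto simp: sum_move_task)
    then show ?thesis
      using assms(2) less.prems(2) kl by (meson converse_rtrancl_into_rtrancl)
  qed simp
qed

lemma sum_balance:
  fixes f g :: "'a::finite \<Rightarrow> 'a \<Rightarrow> real"
  assumes "\<And>k l. A k l \<Longrightarrow> f k l \<noteq> 0 \<Longrightarrow> B l k \<and> w' * g l k = w * f k l"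
    and "\<And>k l. B l k \<Longrightarrow> g l k \<noteq> 0 \<Longrightarrow> A k l \<and> w * f k l = w' * g l k"
  shows "w * (\<Sum>(k, l)\<in>{(k, l). A k l}. f k l) = w' * (\<Sum>(l, k)\<in>{(l, k). B l k}. g l k)"
proof -
  have "(\<Sum>(k, l)\<in>{(k, l). A k l}. w * f k l) = (\<Sum>(l, k)\<in>{(l, k). B l k}. w' * g l k)"
    by (rule sum_pairs_swap) (metis assms mult_zero_right)+
  then show ?thesis
    by (simp add: sum_distrib_left case_prod_unfold)
qed

locale network =
  fixes \<gamma> :: "'a::finite \<Rightarrow> nat \<Rightarrow> real"
    and \<beta> \<theta> \<epsilon> :: "'a \<Rightarrow> 'a \<Rightarrow> nat \<Rightarrow> nat \<Rightarrow> 'a config \<Rightarrow> real"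
    and \<tau> :: "'a \<Rightarrow> 'a \<Rightarrow> ('a \<Rightarrow> nat) \<Rightarrow> 'a config \<Rightarrow> real"
    and M N :: nat
  assumes gamma_nonneg: "\<And>i m. 0 \<le> \<gamma> i m"
    and gamma_bar_pos: "\<And>y n j. (y, n) \<in> states M N \<Longrightarrow> y j \<Longrightarrow> 0 < gamma_bar \<gamma> j (n j)"
    and beta_pos: "\<And>k l a b y. k \<noteq> l \<Longrightarrow> \<not> y k \<Longrightarrow> \<not> y l \<Longrightarrow> 0 < \<beta> k l a b y"
    and theta_pos: "\<And>k l a b y. y k \<noteq> y l \<Longrightarrow> 0 < \<theta> k l a b y"
    and eps_pos: "\<And>i j a b y. i \<noteq> j \<Longrightarrow> y i \<Longrightarrow> y j \<Longrightarrow> 0 < \<epsilon> i j a b y"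
    and tau_pos: "\<And>j j' n y. y j \<Longrightarrow> \<not> y j' \<Longrightarrow> 0 < \<tau> j j' n y"
    and beta_sym: "\<And>k l n y. k \<noteq> l \<Longrightarrow> \<not> y k \<Longrightarrow> \<not> y l \<Longrightarrow> 1 \<le> n k \<Longrightarrow>
          \<beta> k l (n k) (n l) y = \<beta> l k (n l + 1) (n k - 1) y"
    and theta_sym: "\<And>j k n y. y j \<Longrightarrow> \<not> y k \<Longrightarrow> 1 \<le> n j \<Longrightarrow>
          \<theta> j k (n j) (n k) y = \<theta> k j (n k + 1) (n j - 1) y"
    and eps_sym: "\<And>i j n y. i \<noteq> j \<Longrightarrow> y i \<Longrightarrow> y j \<Longrightarrow> 1 \<le> n i \<Longrightarrow>
          \<epsilon> i j (n i) (n j) y * \<gamma> i (n i - 1) = \<gamma> j (n j) * \<epsilon> j i (n j + 1) (n i - 1) y"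
    and tau_sym: "\<And>j j' n y. y j \<Longrightarrow> \<not> y j' \<Longrightarrow>
          \<tau> j j' n y = \<tau> j' j n (move_customer j j' y)"
begin

section \<open>The five kinds of jump and their detailed balance\<close>

abbreviation rate :: "'a state \<Rightarrow> 'a state \<Rightarrow> real" where
  "rate \<equiv> jump_rate \<gamma> \<beta> \<theta> \<epsilon> \<tau>"

definition beta_rate :: "'a state \<Rightarrow> 'a state \<Rightarrow> real" where
  "beta_rate = (\<lambda>(y, n) x'. \<Sum>(k, l) \<in> {(k, l). k \<noteq> l \<and> \<not> y k \<and> \<not> y l \<and> x' = (y, move_task k l n)}.
     \<beta> k l (n k) (n l) y * of_bool (n k \<ge> 1))"

definition eps_rate :: "'a state \<Rightarrow> 'a state \<Rightarrow> real" where
  "eps_rate = (\<lambda>(y, n) x'. \<Sum>(i, j) \<in> {(i, j). i \<noteq> j \<and> y i \<and> y j \<and> x' = (y, move_task i j n)}.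
     \<epsilon> i j (n i) (n j) y * of_bool (n i \<ge> 1))"

definition theta_out_rate :: "'a state \<Rightarrow> 'a state \<Rightarrow> real" where
  "theta_out_rate = (\<lambda>(y, n) x'. \<Sum>(i, l) \<in> {(i, l). y i \<and> \<not> y l \<and> x' = (y, move_task i l n)}.
     \<theta> i l (n i) (n l) y * of_bool (n i \<ge> 1))"

definition theta_in_rate :: "'a state \<Rightarrow> 'a state \<Rightarrow> real" where
  "theta_in_rate = (\<lambda>(y, n) x'. \<Sum>(k, j) \<in> {(k, j). \<not> y k \<and> y j \<and> x' = (y, move_task k j n)}.
     \<theta> k j (n k) (n j) y * \<gamma> j (n j) * of_bool (n k \<ge> 1))"

definition tau_rate :: "'a state \<Rightarrow> 'a state \<Rightarrow> real" where
  "tau_rate = (\<lambda>(y, n) x'. \<Sum>(j, j') \<in> {(j, j'). y j \<and> \<not> y j' \<and> x' = (move_customer j j' y, n)}.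
     inverse (gamma_bar \<gamma> j (n j)) * \<tau> j j' n y)"

lemma rate_eq:
  "rate x x' = beta_rate x x' + eps_rate x x' + theta_out_rate x x' + theta_in_rate x x' + tau_rate x x'"
  by (cases x) (simp add: jump_rate_def beta_rate_def eps_rate_def theta_out_rate_def theta_in_rate_def tau_rate_def)

lemma gamma_bar_nonneg: "0 \<le> gamma_bar \<gamma> j n"
  by (simp add: gamma_bar_def prod_nonneg gamma_nonneg)

lemma weight_pos:
  assumes "x \<in> states M N"
  shows "0 < weight \<gamma> x"
proof (cases x)
  case (Pair y n)
  have "0 < gamma_bar \<gamma> j (n j) ^ of_bool (y j)" for j
    using gamma_bar_pos[of y n j] assms Pair by (cases "y j") auto
  then show ?thesis
    unfolding Pair weight_def prod.case by (intro prod_pos) auto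
qed

text \<open>Free sites contribute the factor 1, so the weight does not change and the symmetry of
  \<open>\<beta>\<close> is all that is required.\<close>

lemma beta_balance:
  assumes "k \<noteq> l" "\<not> y k" "\<not> y l" "1 \<le> n k"
  shows "weight \<gamma> (y, n) * \<beta> k l (n k) (n l) y =
    weight \<gamma> (y, move_task k l n) * \<beta> l k (move_task k l n l) (move_task k l n k) y"
  using assms beta_sym[of k l y n]
  by (simp add: weight_move_task weight_split[of k l] move_task_def)

text \<open>The last factor of \<open>gamma_bar \<gamma> i (n i)\<close> is split off; the symmetry
  condition exchanges it for \<open>\<gamma> j (n j)\<close>, which completes
  \<open>gamma_bar \<gamma> j (n j + 1)\<close>.\<close>

lemma eps_balance:
  assumes "i \<noteq> j" "y i" "y j" "1 \<le> n i"
  shows "weight \<gamma> (y, n) * \<epsilon> i j (n i) (n j) y =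
    weight \<gamma> (y, move_task i j n) * \<epsilon> j i (move_task i j n j) (move_task i j n i) y"
proof -
  obtain m where m: "n i = Suc m" using assms(4) by (cases "n i") auto
  let ?W = "\<Prod>s\<in>UNIV - {i, j}. gamma_bar \<gamma> s (n s) ^ of_bool (y s)"
  have "weight \<gamma> (y, n) * \<epsilon> i j (n i) (n j) y =
      gamma_bar \<gamma> i m * gamma_bar \<gamma> j (n j) * ?W * (\<epsilon> i j (n i) (n j) y * \<gamma> i (n i - 1))"
    unfolding weight_split[OF assms(1)] using assms m by (simp add: gamma_bar_Suc)
  also have "\<dots> = gamma_bar \<gamma> i m * gamma_bar \<gamma> j (n j) * ?W * (\<gamma> j (n j) * \<epsilon> j i (n j + 1) (n i - 1) y)"
    using eps_sym[of i j y n] assms by simp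
  also have "\<dots> = weight \<gamma> (y, move_task i j n) * \<epsilon> j i (move_task i j n j) (move_task i j n i) y"
    unfolding weight_move_task[OF assms(1)] using assms m by (simp add: gamma_bar_Suc move_task_def)
  finally show ?thesis .
qed

text \<open>The factor \<open>\<gamma> i (n i - 1)\<close> that the weight loses when a task leaves
  \<open>i\<close> is the one contained in the rate of the reverse jump.\<close>

lemma theta_balance:
  assumes "y i" "\<not> y l" "1 \<le> n i"
  shows "weight \<gamma> (y, n) * \<theta> i l (n i) (n l) y =
    weight \<gamma> (y, move_task i l n) *
      (\<theta> l i (move_task i l n l) (move_task i l n i) y * \<gamma> i (move_task i l n i))"
proof -
  have neq: "i \<noteq> l" using assms by auto
  obtain m where m: "n i = Suc m" using assms(3) by (cases "n i") auto
  show ?thesis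
    unfolding weight_split[OF neq] weight_move_task[OF neq]
    using theta_sym[of y i l n] assms m neq by (simp add: gamma_bar_Suc move_task_def)
qed

text \<open>The reciprocals cancel the only weight factors in which the two states differ. Both are
  finite: the source state gives positivity at \<open>j\<close>, the target state at
  \<open>j'\<close>.\<close>

lemma tau_balance:
  assumes "(y, n) \<in> states M N" "y j" "\<not> y j'"
  shows "weight \<gamma> (y, n) * (inverse (gamma_bar \<gamma> j (n j)) * \<tau> j j' n y) =
    weight \<gamma> (move_customer j j' y, n) *
      (inverse (gamma_bar \<gamma> j' (n j')) * \<tau> j' j n (move_customer j j' y))"
proof -
  have "0 < gamma_bar \<gamma> j (n j)"
    by (rule gamma_bar_pos[of y n]) (fact assms)+
  moreover have "0 < gamma_bar \<gamma> j' (n j')"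
    using move_customer_in_states[OF assms] by (rule gamma_bar_pos) (rule move_customer_target)
  ultimately show ?thesis
    using weight_move_customer[of y j j' \<gamma> n] assms tau_sym[of y j j' n]
    by (simp add: field_simps)
qed

lemma beta_rate_balance: "weight \<gamma> x * beta_rate x x' = weight \<gamma> x' * beta_rate x' x"
proof (cases x; cases x')
  fix y n y' n' assume [simp]: "x = (y, n)" "x' = (y', n')"
  \<comment> \<open>Stated for arbitrary pairs of states, so that it gives both directions of the
    matching.\<close>
  have *: "(l \<noteq> k \<and> \<not> y' l \<and> \<not> y' k \<and> (y, n) = (y', move_task l k n')) \<and>
    weight \<gamma> (y', n') * (\<beta> l k (n' l) (n' k) y' * of_bool (n' l \<ge> 1)) =
    weight \<gamma> (y, n) * (\<beta> k l (n k) (n l) y * of_bool (n k \<ge> 1))"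
    if "k \<noteq> l \<and> \<not> y k \<and> \<not> y l \<and> (y', n') = (y, move_task k l n)"
      "\<beta> k l (n k) (n l) y * of_bool (n k \<ge> 1) \<noteq> 0" for y n y' n' k l
    using that beta_balance[of k l y n] by (auto simp: move_task_back move_task_target)
  show ?thesis
    unfolding beta_rate_def \<open>x = _\<close> \<open>x' = _\<close> prod.case
    by (rule sum_balance; rule *)
qed

lemma eps_rate_balance: "weight \<gamma> x * eps_rate x x' = weight \<gamma> x' * eps_rate x' x"
proof (cases x; cases x')
  fix y n y' n' assume [simp]: "x = (y, n)" "x' = (y', n')"
  have *: "(j \<noteq> i \<and> y' j \<and> y' i \<and> (y, n) = (y', move_task j i n')) \<and>
    weight \<gamma> (y', n') * (\<epsilon> j i (n' j) (n' i) y' * of_bool (n' j \<ge> 1)) =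
    weight \<gamma> (y, n) * (\<epsilon> i j (n i) (n j) y * of_bool (n i \<ge> 1))"
    if "i \<noteq> j \<and> y i \<and> y j \<and> (y', n') = (y, move_task i j n)"
      "\<epsilon> i j (n i) (n j) y * of_bool (n i \<ge> 1) \<noteq> 0" for y n y' n' i j
    using that eps_balance[of i j y n] by (auto simp: move_task_back move_task_target)
  show ?thesis
    unfolding eps_rate_def \<open>x = _\<close> \<open>x' = _\<close> prod.case
    by (rule sum_balance; rule *)
qed

lemma theta_rate_balance: "weight \<gamma> x * theta_out_rate x x' = weight \<gamma> x' * theta_in_rate x' x"
proof (cases x; cases x')
  fix y n y' n' assume [simp]: "x = (y, n)" "x' = (y', n')"
  have bal: "weight \<gamma> (y, move_task i l n) * (\<theta> l i (move_task i l n l) (move_task i l n i) y *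
        \<gamma> i (move_task i l n i) * of_bool (move_task i l n l \<ge> 1)) =
      weight \<gamma> (y, n) * (\<theta> i l (n i) (n l) y * of_bool (n i \<ge> 1))"
    if "y i" "\<not> y l" "1 \<le> n i" for y n i l
    using that theta_balance[of y i l n] by (simp add: move_task_target)
  show ?thesis
    unfolding theta_out_rate_def theta_in_rate_def \<open>x = _\<close> \<open>x' = _\<close> prod.case
  proof (rule sum_balance)
    fix i l
    assume "y i \<and> \<not> y l \<and> (y', n') = (y, move_task i l n)"
      and "\<theta> i l (n i) (n l) y * of_bool (n i \<ge> 1) \<noteq> 0"
    then show "(\<not> y' l \<and> y' i \<and> (y, n) = (y', move_task l i n')) \<and>
      weight \<gamma> (y', n') * (\<theta> l i (n' l) (n' i) y' * \<gamma> i (n' i) * of_bool (n' l \<ge> 1)) =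
      weight \<gamma> (y, n) * (\<theta> i l (n i) (n l) y * of_bool (n i \<ge> 1))"
      using bal[of y i l n] move_task_back[of i l n] by (cases "i = l") auto
  next
    fix i l
    assume "\<not> y' l \<and> y' i \<and> (y, n) = (y', move_task l i n')"
      and "\<theta> l i (n' l) (n' i) y' * \<gamma> i (n' i) * of_bool (n' l \<ge> 1) \<noteq> 0"
    \<comment> \<open>The nonzero rate forces a task at \<open>l\<close> in \<open>n'\<close>, so
      the move can be undone, and \<open>i\<close> has received a task in \<open>n\<close>. The
      second matching thus follows from the balance of the jump out of \<open>i\<close>.\<close>
    then have *: "\<not> y l" "y i" "y' = y" "n = move_task l i n'" "n' = move_task i l n" "1 \<le> n i"
      using move_task_back[of l i n'] by (auto simp: move_task_def)
    show "(y i \<and> \<not> y l \<and> (y', n') = (y, move_task i l n)) \<and>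
      weight \<gamma> (y, n) * (\<theta> i l (n i) (n l) y * of_bool (n i \<ge> 1)) =
      weight \<gamma> (y', n') * (\<theta> l i (n' l) (n' i) y' * \<gamma> i (n' i) * of_bool (n' l \<ge> 1))"
      unfolding \<open>y' = y\<close> \<open>n' = move_task i l n\<close> by (intro conjI refl bal[of y i l n, symmetric] *(1,2,6))
  qed
qed

lemma tau_rate_balance:
  assumes "x \<in> states M N" "x' \<in> states M N"
  shows "weight \<gamma> x * tau_rate x x' = weight \<gamma> x' * tau_rate x' x"
proof (cases x; cases x')
  fix y n y' n' assume x: "x = (y, n)" "x' = (y', n')"
  have *: "(y' j' \<and> \<not> y' j \<and> (y, n) = (move_customer j' j y', n')) \<and>
    weight \<gamma> (y', n') * (inverse (gamma_bar \<gamma> j' (n' j')) * \<tau> j' j n' y') =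
    weight \<gamma> (y, n) * (inverse (gamma_bar \<gamma> j (n j)) * \<tau> j j' n y)"
    if "(y, n) \<in> states M N" "y j \<and> \<not> y j' \<and> (y', n') = (move_customer j j' y, n)" for y n y' n' j j'
    using that tau_balance[of y n j j'] move_customer_back[of y j j']
      move_customer_source[of j j' y] move_customer_target[of j j' y]
    by auto
  show ?thesis
    unfolding tau_rate_def x prod.case
    by (rule sum_balance; rule *) (use assms x in auto)
qed

lemma rate_balance:
  assumes "x \<in> states M N" "x' \<in> states M N"
  shows "weight \<gamma> x * rate x x' = weight \<gamma> x' * rate x' x"
  unfolding rate_eq distrib_left
  using beta_rate_balance[of x x'] eps_rate_balance[of x x'] theta_rate_balance[of x x']
    theta_rate_balance[of x' x] tau_rate_balance[OF assms]
  by simp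

section \<open>Positivity of rates and irreducibility\<close>

lemma rates_nonneg:
  "0 \<le> beta_rate x x'" "0 \<le> eps_rate x x'" "0 \<le> theta_out_rate x x'"
  "0 \<le> theta_in_rate x x'" "0 \<le> tau_rate x x'"
  unfolding beta_rate_def eps_rate_def theta_out_rate_def theta_in_rate_def tau_rate_def case_prod_unfold
  by (auto intro!: sum_nonneg mult_nonneg_nonneg gamma_nonneg gamma_bar_nonneg
      less_imp_le[OF beta_pos] less_imp_le[OF eps_pos] less_imp_le[OF theta_pos] less_imp_le[OF tau_pos])

lemma rate_move_task_pos:
  assumes S: "(y, n) \<in> states M N" and kl: "k \<noteq> l" "1 \<le> n k"
  shows "0 < rate (y, n) (y, move_task k l n)"
proof -
  let ?x' = "(y, move_task k l n)"
  have pos: "0 < (\<Sum>(k, l)\<in>{(k, l). A k l}. f k l)"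
    if "A k l" "0 < f k l" "\<And>k l. A k l \<Longrightarrow> 0 \<le> f k l" for A and f :: "'a \<Rightarrow> 'a \<Rightarrow> real"
    by (rule sum_pos2[of _ "(k, l)"]) (use that in auto)
  have "0 < beta_rate (y, n) ?x' \<or> 0 < eps_rate (y, n) ?x' \<or>
      0 < theta_out_rate (y, n) ?x' \<or> 0 < theta_in_rate (y, n) ?x'"
  proof (cases "y k"; cases "y l")
    assume "y k" "y l"
    then have "0 < eps_rate (y, n) ?x'"
      unfolding eps_rate_def prod.case by (intro pos) (use kl in \<open>auto intro: eps_pos less_imp_le\<close>)
    then show ?thesis by simp
  next
    assume "y k" "\<not> y l"
    then have "0 < theta_out_rate (y, n) ?x'"
      unfolding theta_out_rate_def prod.case by (intro pos) (use kl in \<open>auto intro: theta_pos less_imp_le\<close>)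
    then show ?thesis by simp
  next
    assume y: "\<not> y k" "y l"
    \<comment> \<open>Entering an occupied site is the only task move whose rate contains
      \<open>\<gamma>\<close>. The value \<open>\<gamma> l (n l)\<close> is a factor of
      \<open>gamma_bar \<gamma> l (n l + 1)\<close>, which is positive because the target is again
      an admissible state.\<close>
    have "0 < gamma_bar \<gamma> l (Suc (n l))"
      using gamma_bar_pos[OF move_task_in_states[of y n M N k l, OF S kl] y(2)] kl by (simp add: move_task_def)
    then have "0 < \<gamma> l (n l)"
      using gamma_nonneg[of l "n l"] by (auto simp: gamma_bar_Suc less_le)
    then have "0 < theta_in_rate (y, n) ?x'"
      unfolding theta_in_rate_def prod.case using y
      by (intro pos) (use kl gamma_nonneg in \<open>auto intro!: mult_pos_pos mult_nonneg_nonneg theta_pos less_imp_le[OF theta_pos]\<close>)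
    then show ?thesis by simp
  next
    assume "\<not> y k" "\<not> y l"
    then have "0 < beta_rate (y, n) ?x'"
      unfolding beta_rate_def prod.case by (intro pos) (use kl in \<open>auto intro: beta_pos less_imp_le\<close>)
    then show ?thesis by simp
  qed
  then show ?thesis
    unfolding rate_eq using rates_nonneg[of "(y, n)" ?x'] by linarith
qed

lemma rate_move_customer_pos:
  assumes S: "(y, n) \<in> states M N" and y: "y j" "\<not> y j'"
  shows "0 < rate (y, n) (move_customer j j' y, n)"
proof -
  have "0 < tau_rate (y, n) (move_customer j j' y, n)"
    unfolding tau_rate_def prod.case
    by (rule sum_pos2[of _ "(j, j')"])
      (use S y gamma_bar_pos in \<open>auto intro!: mult_pos_pos mult_nonneg_nonneg tau_pos less_imp_le[OF tau_pos] gamma_bar_nonneg\<close>)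
  then show ?thesis
    unfolding rate_eq using rates_nonneg[of "(y, n)" "(move_customer j j' y, n)"] by linarith
qed

text \<open>Tasks are rearranged with the customers fixed, then customers with the tasks fixed. The
  first stage can use any pair of sites, since one of the four task mechanisms applies whatever
  their occupation.\<close>

lemma irreducible:
  assumes "x \<in> states M N" "x' \<in> states M N"
  shows "(x, x') \<in> {(x, z). x \<in> states M N \<and> z \<in> states M N \<and> 0 < generator (states M N) rate x z}\<^sup>*"
    (is "_ \<in> ?r\<^sup>*")
proof (cases x; cases x')
  fix y n y' n' assume x: "x = (y, n)" "x' = (y', n')"
  have S: "(y, n') \<in> states M N"
    using assms by (auto simp: x states_def)
  have "((y, n), (y, n')) \<in> ?r\<^sup>*"
  proof (rule move_task_connected[where f = "\<lambda>n. (y, n)" and Q = "\<lambda>n. (y, n) \<in> states M N"])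
    fix n k l assume n: "(y, n) \<in> states M N" "n' k < n k" "n l < n' l"
    then have kl: "k \<noteq> l" "1 \<le> n k" by auto
    \<comment> \<open>On the diagonal \<open>generator\<close> is minus the exit rate, so source and
      target must be known to differ before the positive rate counts.\<close>
    have "move_task k l n l \<noteq> n l" by (simp add: move_task_def)
    then have "move_task k l n \<noteq> n" by metis
    then show "(y, move_task k l n) \<in> states M N \<and> ((y, n), (y, move_task k l n)) \<in> ?r"
      using move_task_in_states[of y n M N k l, OF n(1) kl] rate_move_task_pos[of y n k l, OF n(1) kl] n(1)
      by (simp add: generator_def)
  qed (use assms x in \<open>auto simp: states_def\<close>)
  moreover have "((y, n'), (y', n')) \<in> ?r\<^sup>*"
  proof -
    \<comment> \<open>This decodes 0-1 vectors as configurations; the bound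
      \<open>a s \<le> 1\<close> in the invariant ensures that a moved unit decodes to a moved
      customer.\<close>
    let ?f = "\<lambda>a. (\<lambda>s. a s = (1::nat), n')"
    have "(?f (\<lambda>s. of_bool (y s)), ?f (\<lambda>s. of_bool (y' s))) \<in> ?r\<^sup>*"
    proof (rule move_task_connected[where f = ?f and Q = "\<lambda>a. (\<forall>s. a s \<le> 1) \<and> ?f a \<in> states M N"])
      show "(\<Sum>s\<in>UNIV. of_bool (y s) :: nat) = (\<Sum>s\<in>UNIV. of_bool (y' s))"
        using assms unfolding x states_def by (simp del: sum_of_bool_eq)
      show "(\<forall>s. of_bool (y s) \<le> (1::nat)) \<and> ?f (\<lambda>s. of_bool (y s)) \<in> states M N"
        using S by (simp add: of_bool_def)
    next
      fix a k l
      assume a: "(\<forall>s. a s \<le> 1) \<and> ?f a \<in> states M N"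
        and k: "of_bool (y' k) < a k" and l: "a l < of_bool (y' l)"
      have "a k \<le> 1" using a by blast
      then have kl: "a k = 1" "a l = 0" "k \<noteq> l"
        using k l by (auto simp: of_bool_def split: if_splits)
      then have f: "?f (move_task k l a) = (move_customer k l (\<lambda>s. a s = 1), n')"
        by (auto simp: move_task_def move_customer_def fun_eq_iff)
      have S': "?f a \<in> states M N" using a by blast
      have "(move_customer k l (\<lambda>s. a s = 1), n') \<in> states M N"
        by (rule move_customer_in_states[OF S']) (use kl in auto)
      moreover have "0 < rate (?f a) (move_customer k l (\<lambda>s. a s = 1), n')"
        by (rule rate_move_customer_pos[OF S']) (use kl in auto)
      moreover have "move_customer k l (\<lambda>s. a s = 1) l \<noteq> (a l = 1)"
        using kl by (simp add: move_customer_def)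
      then have "move_customer k l (\<lambda>s. a s = 1) \<noteq> (\<lambda>s. a s = 1)"
        by metis
      moreover have "move_task k l a s \<le> 1" for s
        using kl a by (auto simp: move_task_def)
      ultimately show "((\<forall>s. move_task k l a s \<le> 1) \<and> ?f (move_task k l a) \<in> states M N) \<and>
          (?f a, ?f (move_task k l a)) \<in> ?r"
        unfolding f using S' by (simp add: generator_def)
    qed
    moreover have "(\<lambda>s. of_bool (b s) = (1::nat)) = b" for b :: "'a config"
      by (simp add: fun_eq_iff)
    ultimately show ?thesis by (simp only:)
  qed
  ultimately show ?thesis
    unfolding x by (rule rtrancl_trans)
qed

end

lemma states_nonempty:
  assumes "M \<le> CARD('a::finite)"
  shows "(states M N :: 'a state set) \<noteq> {}"
proof -
  obtain A :: "'a set" where "card A = M"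
    using obtain_subset_with_card_n[OF assms] by blast
  then have "((\<lambda>s. s \<in> A), (\<lambda>s. if s = undefined then N else 0)) \<in> states M N"
    by (simp add: states_def)
  then show ?thesis by blast
qed

theorem theorem4p3:
  fixes \<gamma> :: "'a::finite \<Rightarrow> nat \<Rightarrow> real"
    and \<beta> \<theta> \<epsilon> :: "'a \<Rightarrow> 'a \<Rightarrow> nat \<Rightarrow> nat \<Rightarrow> 'a config \<Rightarrow> real"
    and \<tau> :: "'a \<Rightarrow> 'a \<Rightarrow> ('a \<Rightarrow> nat) \<Rightarrow> 'a config \<Rightarrow> real"
    and M N :: nat
    and P :: "'a state \<Rightarrow> 'w measure"
    and X :: "real \<Rightarrow> 'w \<Rightarrow> 'a state"
  defines "S \<equiv> states M N :: 'a state set"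
    and "R \<equiv> generator (states M N) (jump_rate \<gamma> \<beta> \<theta> \<epsilon> \<tau>)"
  assumes M: "1 \<le> M" "M \<le> CARD('a)"
    and N: "1 \<le> N"
    and gamma_nonneg: "\<And>i m. 0 \<le> \<gamma> i m"
    and gamma_0: "\<And>i. \<gamma> i 0 = 1"
    and gamma_pos: "\<And>i m. 0 < \<gamma> i (m + 1) \<Longrightarrow> 0 < \<gamma> i m"
    and gamma_bar_pos: "\<And>y n j. (y, n) \<in> S \<Longrightarrow> y j \<Longrightarrow> 0 < gamma_bar \<gamma> j (n j)"
    and beta_pos: "\<And>k l a b y. k \<noteq> l \<Longrightarrow> \<not> y k \<Longrightarrow> \<not> y l \<Longrightarrow> 0 < \<beta> k l a b y"
    and theta_pos: "\<And>k l a b y. y k \<noteq> y l \<Longrightarrow> 0 < \<theta> k l a b y"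
    and eps_pos: "\<And>i j a b y. i \<noteq> j \<Longrightarrow> y i \<Longrightarrow> y j \<Longrightarrow> 0 < \<epsilon> i j a b y"
    and tau_pos: "\<And>j j' n y. y j \<Longrightarrow> \<not> y j' \<Longrightarrow> 0 < \<tau> j j' n y"
    and beta_sym: "\<And>k l n y. k \<noteq> l \<Longrightarrow> \<not> y k \<Longrightarrow> \<not> y l \<Longrightarrow> 1 \<le> n k \<Longrightarrow>
          \<beta> k l (n k) (n l) y = \<beta> l k (n l + 1) (n k - 1) y"
    and theta_sym: "\<And>j k n y. y j \<Longrightarrow> \<not> y k \<Longrightarrow> 1 \<le> n j \<Longrightarrow>
          \<theta> j k (n j) (n k) y = \<theta> k j (n k + 1) (n j - 1) y"
    and eps_sym: "\<And>i j n y. i \<noteq> j \<Longrightarrow> y i \<Longrightarrow> y j \<Longrightarrow> 1 \<le> n i \<Longrightarrow>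
          \<epsilon> i j (n i) (n j) y * \<gamma> i (n i - 1) = \<gamma> j (n j) * \<epsilon> j i (n j + 1) (n i - 1) y"
    and tau_sym: "\<And>j j' n y. y j \<Longrightarrow> \<not> y j' \<Longrightarrow>
          \<tau> j j' n y = \<tau> j' j n (move_customer j j' y)"
    and process: "markov_process S R P X"
  shows "positive_recurrent S R P X \<and>
         reversible S P X (stat_prob M N \<gamma>) \<and>
         stationary_distribution S P X (stat_prob M N \<gamma>) \<and>
         (\<forall>\<nu>. stationary_distribution S P X \<nu> \<longrightarrow> (\<forall>x\<in>S. \<nu> x = stat_prob M N \<gamma> x))"
proof -
  interpret network \<gamma> \<beta> \<theta> \<epsilon> \<tau> M N
    using gamma_nonneg gamma_bar_pos beta_pos theta_pos eps_pos tau_pos beta_sym theta_sym eps_sym tau_sym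
    unfolding S_def by (rule network.intro)
  interpret finite_markov_process S R P X
    using finite_states process by (simp add: finite_markov_process_def S_def)
  have Z: "0 < partition_function M N \<gamma>"
    unfolding partition_function_def using states_nonempty[OF M(2)] weight_pos finite_states
    by (intro sum_pos) auto
  have stat_prob: "stat_prob M N \<gamma> x = weight \<gamma> x / partition_function M N \<gamma>" if "x \<in> S" for x
    using that by (simp add: stat_prob_def S_def)
  \<comment> \<open>The partition function is common to both sides, and off the diagonal
    \<open>generator\<close> is the jump rate.\<close>
  have db: "stat_prob M N \<gamma> x * R x z = stat_prob M N \<gamma> z * R z x" if "x \<in> S" "z \<in> S" for x z
    using that rate_balance[of x z] by (cases "x = z") (auto simp: stat_prob R_def generator_def S_def)
  have pos: "0 < stat_prob M N \<gamma> x" if "x \<in> S" for x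
    using that weight_pos Z by (simp add: stat_prob S_def)
  have sum: "sum (stat_prob M N \<gamma>) S = 1"
    using Z by (simp add: stat_prob sum_divide_distrib[symmetric] partition_function_def S_def)
  have irr: "(x, z) \<in> edges\<^sup>*" if "x \<in> S" "z \<in> S" for x z
    unfolding edges_def using irreducible that by (simp add: R_def S_def)
  show ?thesis
    using positive_recurrentI[OF irr] reversibleI[OF db] stationary_distributionI[OF db less_imp_le[OF pos] sum]
      stationary_distribution_unique[OF db pos sum irr]
    by blast
qed

end
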